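(* The following two properties of a set $A\subset\mathbb N$ are equivalent: 1) $h(f)=h\left(f|\overline{K_f(A)}\right)$ for any continuous map $f:[0,1]\to[0,1]$; 2) for any $k\in\mathbb N$ there exists $n\in A$ which is a multiple of $k$.
   Context: $\mathbb N$ is the set of positive integers. For a continuous $f:[0,1]\to[0,1]$ and $A\subset\mathbb N$, $K_f(A)$ is the set of periodic points $y$ of $f$ whose minimal period belongs to $A$. $h$ denotes topological entropy (with the convention that the entropy on the empty set is $0$). *)

theory Defs
  imports "HOL-Analysis.Analysis"
begin

text \<open>Topological entropy of \<open>f\<close> restricted to a set \<open>X\<close> with \<open>f ` X \<subseteq> X\<close>, by Bowen's
  separated sets. For compact \<open>X\<close> and \<open>f\<close> continuous on \<open>X\<close> this is the topological entropy of
  the system \<open>(X, f)\<close>.\<close>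

definition separated :: "('a::metric_space \<Rightarrow> 'a) \<Rightarrow> nat \<Rightarrow> real \<Rightarrow> 'a set \<Rightarrow> bool" where
  "separated f n \<epsilon> E \<longleftrightarrow>
     (\<forall>x\<in>E. \<forall>y\<in>E. x \<noteq> y \<longrightarrow> (\<exists>i<n. dist ((f ^^ i) x) ((f ^^ i) y) > \<epsilon>))"

text \<open>The inner supremum is \<open>(1/n) log s(n, \<epsilon>)\<close>, where \<open>s(n, \<epsilon>)\<close> is the maximal cardinality of an
  \<open>(n, \<epsilon>)\<close>-separated subset of \<open>X\<close>. The irrelevant term for \<open>n = 0\<close> is \<open>0\<close>.\<close>

definition separated_growth ::
  "('a::metric_space \<Rightarrow> 'a) \<Rightarrow> 'a set \<Rightarrow> real \<Rightarrow> ereal" where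
  "separated_growth f X \<epsilon> =
     limsup (\<lambda>n. SUP E \<in> {E. E \<subseteq> X \<and> finite E \<and> E \<noteq> {} \<and> separated f n \<epsilon> E}.
       ereal (ln (real (card E)) / real n))"

text \<open>The growth rate is antimonotone in \<open>\<epsilon>\<close>, so the supremum over \<open>\<epsilon> > 0\<close> is the usual limit as
  \<open>\<epsilon>\<close> tends to \<open>0\<close> from the right; see \<open>topological_entropy_limit\<close>. The entropy on the empty set
  is \<open>0\<close> by convention.\<close>

definition topological_entropy :: "('a::metric_space \<Rightarrow> 'a) \<Rightarrow> 'a set \<Rightarrow> ereal" where
  "topological_entropy f X =
     (if X = {} then 0 else SUP \<epsilon> \<in> {0<..}. separated_growth f X \<epsilon>)"

definition minimal_period :: "('a \<Rightarrow> 'a) \<Rightarrow> 'a \<Rightarrow> nat \<Rightarrow> bool" where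
  "minimal_period f y n \<longleftrightarrow>
     0 < n \<and> (f ^^ n) y = y \<and> (\<forall>m. 0 < m \<and> m < n \<longrightarrow> (f ^^ m) y \<noteq> y)"

definition periodic_points :: "(real \<Rightarrow> real) \<Rightarrow> nat set \<Rightarrow> real set" where
  "periodic_points f A = {y \<in> {0..1}. \<exists>n\<in>A. minimal_period f y n}"

lemma separated_growth_antimono:
  assumes "\<delta> \<le> \<epsilon>"
  shows "separated_growth f X \<epsilon> \<le> separated_growth f X \<delta>"
  unfolding separated_growth_def
proof (intro Limsup_mono always_eventually allI SUP_subset_mono order_refl)
  fix n
  have "separated f n \<delta> E" if "separated f n \<epsilon> E" for E
    using that assms unfolding separated_def by (meson order.strict_trans1)
  then show "{E. E \<subseteq> X \<and> finite E \<and> E \<noteq> {} \<and> separated f n \<epsilon> E}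
      \<subseteq> {E. E \<subseteq> X \<and> finite E \<and> E \<noteq> {} \<and> separated f n \<delta> E}"
    by blast
qed

lemma topological_entropy_limit:
  assumes "X \<noteq> {}"
  shows "(separated_growth f X \<longlongrightarrow> topological_entropy f X) (at_right 0)"
proof (rule order_tendstoI)
  fix a assume "a < topological_entropy f X"
  then obtain e where e: "e > 0" "a < separated_growth f X e"
    using assms unfolding topological_entropy_def by (auto simp: less_SUP_iff)
  have "\<forall>d>0. d < e \<longrightarrow> a < separated_growth f X d"
    using e(2) separated_growth_antimono by (meson less_imp_le order.strict_trans2)
  then show "\<forall>\<^sub>F d in at_right 0. a < separated_growth f X d"
    using e(1) unfolding eventually_at_right_field by blast
next
  fix a assume a: "topological_entropy f X < a"
  have "separated_growth f X d < a" if "d > 0" for d :: real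
  proof -
    have "separated_growth f X d \<le> topological_entropy f X"
      using assms that unfolding topological_entropy_def by (auto intro: SUP_upper)
    then show ?thesis using a by (rule order.strict_trans1)
  qed
  then show "\<forall>\<^sub>F d in at_right 0. separated_growth f X d < a"
    unfolding eventually_at_right_field by (meson zero_less_one)
qed

lemma periodic_points_subset: "periodic_points f A \<subseteq> {0..1}"
  by (auto simp: periodic_points_def)

lemma minimal_period_image:
  assumes "minimal_period f y n"
  shows "minimal_period f (f y) n"
proof -
  have n: "0 < n" "(f ^^ n) y = y" and least: "\<And>m. 0 < m \<Longrightarrow> m < n \<Longrightarrow> (f ^^ m) y \<noteq> y"
    using assms by (auto simp: minimal_period_def)
  have step: "(f ^^ m) (f y) = f ((f ^^ m) y)" for m
    by (simp add: funpow_swap1)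
  have "(f ^^ m) y = y" if "(f ^^ m) (f y) = f y" for m
  proof -
    have prev: "(f ^^ (n - 1)) (f z) = (f ^^ n) z" for z
      using n(1) by (metis Suc_diff_1 comp_apply funpow_Suc_right)
    have "(f ^^ n) ((f ^^ m) y) = (f ^^ n) y"
      using that step prev by metis
    moreover have "(f ^^ n) ((f ^^ m) y) = (f ^^ m) ((f ^^ n) y)"
      by (metis add.commute comp_apply funpow_add)
    ultimately show ?thesis using n(2) by simp
  qed
  then show ?thesis
    using n least step by (auto simp: minimal_period_def)
qed

lemma closure_periodic_points_invariant:
  assumes "continuous_on {0..1} f" and "f ` {0..1} \<subseteq> {0..1}"
  shows "f ` closure (periodic_points f A) \<subseteq> closure (periodic_points f A)"
proof -
  have sub: "closure (periodic_points f A) \<subseteq> {0..1}"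
    by (rule closure_minimal[OF periodic_points_subset]) simp
  have "f ` periodic_points f A \<subseteq> periodic_points f A"
    using assms(2) minimal_period_image by (fastforce simp: periodic_points_def)
  then have "f ` periodic_points f A \<subseteq> closure (periodic_points f A)"
    using closure_subset by blast
  then show ?thesis
    by (rule image_closure_subset[OF continuous_on_subset[OF assms(1) sub] closed_closure])
qed

end

theory Submission
  imports Defs
begin

text \<open>Suppose \<open>A\<close> contains a multiple of every \<open>k\<close>. If the entropy of \<open>f\<close> exceeds \<open>\<kappa>\<close>, then by
  Misiurewicz's theorem some iterate \<open>f\<^sup>M\<close> has \<open>s + 1\<close> disjoint closed intervals, each of which it
  maps over all of them, with \<open>ln s / M \<ge> \<kappa>\<close>. The periodic points that follow a periodic word of
  length \<open>m\<close> in these intervals have \<open>f\<close>-period exactly \<open>M * m\<close> once \<open>M\<close> divides \<open>m\<close>, and a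
  multiple of \<open>M\<^sup>2\<close> in \<open>A\<close> provides such an \<open>m\<close>. To find the intervals, cut \<open>[0, 1]\<close> into small
  cells and follow the image of a cell under a high iterate, intersected with the cell visited at
  each step. At each step all but at most four of the nonempty intersections are full cells, where
  the past is forgotten, so exponential growth of the number of words forces one cell to have many
  return words.

  Conversely, suppose \<open>A\<close> contains no multiple of \<open>k \<ge> 2\<close>. Take a map that permutes \<open>k\<close> disjoint
  intervals cyclically, is affine with bounded slope outside the first interval, and oscillates
  there so often that its entropy exceeds the logarithm of the slope bound. Points of the first
  interval have periods divisible by \<open>k\<close>, hence the closure of \<open>K\<^sub>f(A)\<close> only sees the bounded slope.\<close>

section \<open>Interval maps and coverings\<close>

lemma minimal_period_dvd:
  assumes "minimal_period f y n" "(f ^^ m) y = y"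
  shows "n dvd m"
proof (rule ccontr)
  assume "\<not> n dvd m"
  moreover have "0 < n" "(f ^^ n) y = y" using assms(1) by (auto simp: minimal_period_def)
  ultimately have "0 < m mod n" "m mod n < n" "(f ^^ (m mod n)) y = y"
    using assms(2) by (auto simp: mod_greater_zero_iff_not_dvd funpow_mod_eq)
  then show False using assms(1) by (auto simp: minimal_period_def)
qed

lemma continuous_on_funpow:
  assumes "continuous_on X f" "f ` X \<subseteq> X"
  shows "continuous_on X (f ^^ n)"
proof (induction n)
  case (Suc n)
  have "(f ^^ n) ` X \<subseteq> X" using assms(2) by (induction n) auto
  then show ?case
    using continuous_on_compose[OF Suc continuous_on_subset[OF assms(1)]] by (simp add: o_def)
qed (simp add: id_def)

lemma funpow_image_subset:
  assumes "f ` X \<subseteq> X"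
  shows "(f ^^ n) ` X \<subseteq> X"
  using assms by (induction n) auto

text \<open>Let \<open>p\<close> be the last point with value \<open>c\<close> and \<open>q\<close>
  the first point after \<open>p\<close> with value \<open>d\<close>. Between them the values stay
  in \<open>{c..d}\<close>: otherwise the intermediate value theorem would give a later point with
  value \<open>c\<close> or an earlier one with value \<open>d\<close>.\<close>

lemma subinterval_image_eq_aux:
  fixes g :: "real \<Rightarrow> real"
  assumes "x \<le> y" "g x = c" "g y = d" "continuous_on {x..y} g" "c \<le> d"
  shows "\<exists>u v. x \<le> u \<and> u \<le> v \<and> v \<le> y \<and> g ` {u..v} = {c..d}"
proof -
  have "closed ({x..y} \<inter> g -` {c})"
    using continuous_closed_preimage[OF assms(4) closed_atLeastAtMost closed_singleton] .
  then have "compact ({x..y} \<inter> g -` {c})"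
    by (simp add: compact_eq_bounded_closed bounded_Int)
  moreover have "{x..y} \<inter> g -` {c} \<noteq> {}" using assms by auto
  ultimately obtain p where p: "p \<in> {x..y} \<inter> g -` {c}" "\<And>z. z \<in> {x..y} \<inter> g -` {c} \<Longrightarrow> z \<le> p"
    using compact_attains_sup by metis
  have conp: "continuous_on {p..y} g" using assms(4) p(1) by (auto intro: continuous_on_subset)
  have "closed ({p..y} \<inter> g -` {d})"
    using continuous_closed_preimage[OF conp closed_atLeastAtMost closed_singleton] .
  then have "compact ({p..y} \<inter> g -` {d})"
    by (simp add: compact_eq_bounded_closed bounded_Int)
  moreover have "{p..y} \<inter> g -` {d} \<noteq> {}" using assms p(1) by auto
  ultimately obtain q where q: "q \<in> {p..y} \<inter> g -` {d}" "\<And>z. z \<in> {p..y} \<inter> g -` {d} \<Longrightarrow> q \<le> z"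
    using compact_attains_inf by metis
  have conq: "continuous_on {p..q} g" using conp q(1) by (auto intro: continuous_on_subset)
  have pq: "x \<le> p" "p \<le> q" "q \<le> y" "g p = c" "g q = d" using p(1) q(1) by auto
  have "c \<le> g z \<and> g z \<le> d" if z: "z \<in> {p..q}" for z
  proof (rule conjI; rule ccontr)
    assume "\<not> c \<le> g z"
    then obtain w where "z \<le> w" "w \<le> q" "g w = c"
      using IVT'[of g z c q] z pq assms(5) continuous_on_subset[OF conq, of "{z..q}"] by auto
    then have "z = p" using p(2)[of w] z pq by auto
    then show False using \<open>\<not> c \<le> g z\<close> pq by auto
  next
    assume "\<not> g z \<le> d"
    then obtain w where "p \<le> w" "w \<le> z" "g w = d"
      using IVT'[of g p d z] z pq assms(5) continuous_on_subset[OF conq, of "{p..z}"] by auto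
    then have "z = q" using q(2)[of w] z pq by auto
    then show False using \<open>\<not> g z \<le> d\<close> pq by auto
  qed
  moreover have "t \<in> g ` {p..q}" if "t \<in> {c..d}" for t
    using IVT'[of g p t q] that pq conq by force
  ultimately have "g ` {p..q} = {c..d}" by auto
  then show ?thesis using pq by blast
qed

lemma subinterval_image_eq:
  fixes g :: "real \<Rightarrow> real"
  assumes cont: "continuous_on {u..v} g" and "c \<le> d" and sub: "{c..d} \<subseteq> g ` {u..v}"
  shows "\<exists>u' v'. u \<le> u' \<and> u' \<le> v' \<and> v' \<le> v \<and> g ` {u'..v'} = {c..d}"
proof -
  have "c \<in> g ` {u..v}" "d \<in> g ` {u..v}"
    by (rule subsetD[OF sub], simp add: \<open>c \<le> d\<close>)+
  then obtain x y where xy: "x \<in> {u..v}" "y \<in> {u..v}" "g x = c" "g y = d" by blast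
  show ?thesis
  proof (cases "x \<le> y")
    case True
    have "continuous_on {x..y} g" using cont xy by (auto intro: continuous_on_subset)
    from subinterval_image_eq_aux[OF True xy(3,4) this \<open>c \<le> d\<close>] xy show ?thesis
      by (meson atLeastAtMost_iff order_trans)
  next
    case False
    \<comment> \<open>Here \<open>d\<close> is attained to the left of \<open>c\<close>; the
      function \<open>-g\<close> takes \<open>-d\<close> first and \<open>-c\<close> last, so the
      increasing case applies to it.\<close>
    have "continuous_on {y..x} (\<lambda>t. - g t)"
      using cont xy by (auto intro!: continuous_on_minus intro: continuous_on_subset)
    from subinterval_image_eq_aux[OF _ _ _ this, of "-d" "-c"] xy False \<open>c \<le> d\<close>
    obtain p q where pq: "y \<le> p" "p \<le> q" "q \<le> x" "(\<lambda>t. - g t) ` {p..q} = {-d..-c}" by auto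
    have "g ` {p..q} = uminus ` ((\<lambda>t. - g t) ` {p..q})" by (auto simp: image_image)
    also have "\<dots> = {c..d}" using pq(4) by simp
    finally show ?thesis using pq xy by (meson atLeastAtMost_iff order_trans)
  qed
qed

text \<open>Induction from the front of the chain: the interval found for the shifted sequence lies
  in \<open>I 1\<close>, hence in the image of \<open>I 0\<close>, and some subinterval of
  \<open>I 0\<close> is mapped exactly onto it. Exactness makes the last image all of
  \<open>I n\<close>.\<close>

lemma covering_chain:
  fixes g :: "real \<Rightarrow> real" and I :: "nat \<Rightarrow> real set"
  assumes cont: "continuous_on X g"
    and int: "\<And>i. i \<le> n \<Longrightarrow> \<exists>c d. c \<le> d \<and> I i = {c..d}"
    and X: "\<And>i. i < n \<Longrightarrow> I i \<subseteq> X"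
    and cov: "\<And>i. i < n \<Longrightarrow> I (Suc i) \<subseteq> g ` I i"
  shows "\<exists>u v. u \<le> v \<and> (\<forall>i\<le>n. (g ^^ i) ` {u..v} \<subseteq> I i) \<and> (g ^^ n) ` {u..v} = I n"
  using int X cov
proof (induction n arbitrary: I)
  case 0
  then show ?case by fastforce
next
  case (Suc n)
  have "\<exists>u v. u \<le> v \<and> (\<forall>i\<le>n. (g ^^ i) ` {u..v} \<subseteq> I (Suc i)) \<and> (g ^^ n) ` {u..v} = I (Suc n)"
    by (rule Suc.IH) (use Suc.prems in auto)
  then obtain u v where uv: "u \<le> v" "\<And>i. i \<le> n \<Longrightarrow> (g ^^ i) ` {u..v} \<subseteq> I (Suc i)"
      "(g ^^ n) ` {u..v} = I (Suc n)" by blast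
  obtain c d where cd: "I 0 = {c..d}" using Suc.prems(1)[of 0] by auto
  have "{u..v} \<subseteq> g ` {c..d}" using uv(2)[of 0] Suc.prems(3)[of 0] cd by auto
  moreover have "continuous_on {c..d} g"
    using cont Suc.prems(2)[of 0] cd by (auto intro: continuous_on_subset)
  ultimately obtain u' v' where uv': "c \<le> u'" "u' \<le> v'" "v' \<le> d" "g ` {u'..v'} = {u..v}"
    using subinterval_image_eq uv(1) by meson
  have eq: "(g ^^ Suc i) ` {u'..v'} = (g ^^ i) ` {u..v}" for i
    by (metis funpow_Suc_right image_comp uv'(4))
  have "(g ^^ i) ` {u'..v'} \<subseteq> I i" if "i \<le> Suc n" for i
  proof (cases i)
    case 0
    then show ?thesis using uv' cd by auto
  next
    case (Suc j)
    then show ?thesis using eq[of j] uv(2)[of j] that by auto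
  qed
  moreover have "(g ^^ Suc n) ` {u'..v'} = I (Suc n)" using eq uv(3) by blast
  ultimately show ?case using uv'(2) by blast
qed

text \<open>The interval need not be mapped into itself, yet \<open>g t - t\<close> changes sign: it
  is nonpositive at a preimage of \<open>u\<close> and nonnegative at a preimage of
  \<open>v\<close>.\<close>

lemma covering_fixpoint:
  fixes g :: "real \<Rightarrow> real"
  assumes cont: "continuous_on {u..v} g" and "u \<le> v" and sub: "{u..v} \<subseteq> g ` {u..v}"
  shows "\<exists>x\<in>{u..v}. g x = x"
proof -
  have "u \<in> g ` {u..v}" "v \<in> g ` {u..v}"
    by (rule subsetD[OF sub], simp add: \<open>u \<le> v\<close>)+
  then obtain x y where xy: "x \<in> {u..v}" "y \<in> {u..v}" "g x = u" "g y = v" by blast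
  define h where "h t = g t - t" for t
  have con: "continuous_on {u..v} h" unfolding h_def by (intro continuous_intros cont)
  have "connected (h ` {u..v})" by (rule connected_continuous_image[OF con connected_Icc])
  moreover have "h x \<le> 0" "0 \<le> h y" using xy by (auto simp: h_def)
  ultimately have "0 \<in> h ` {u..v}"
    using connectedD_interval[OF _ imageI[OF xy(1)] imageI[OF xy(2)]] by blast
  then show ?thesis by (auto simp: h_def)
qed

text \<open>Each pair has positive distance; the filter \<open>at_right 0\<close> replaces the
  minimum over the finitely many pairs.\<close>

lemma finite_disjoint_compact_gap:
  fixes K :: "'i \<Rightarrow> 'a::heine_borel set"
  assumes "finite J" "\<And>j. j \<in> J \<Longrightarrow> compact (K j)"
    and dis: "\<And>i j. i \<in> J \<Longrightarrow> j \<in> J \<Longrightarrow> i \<noteq> j \<Longrightarrow> K i \<inter> K j = {}"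
  shows "\<exists>\<epsilon>>0. \<forall>i\<in>J. \<forall>j\<in>J. i \<noteq> j \<longrightarrow> (\<forall>x\<in>K i. \<forall>y\<in>K j. \<epsilon> < dist x y)"
proof -
  have "\<forall>\<^sub>F e in at_right 0. i \<noteq> j \<longrightarrow> (\<forall>x\<in>K i. \<forall>y\<in>K j. e < dist x y)"
    if ij: "i \<in> J" "j \<in> J" for i j
  proof (cases "i = j")
    case False
    have "\<exists>d>0. \<forall>x\<in>K i. \<forall>y\<in>K j. d \<le> dist x y"
      using separate_compact_closed[OF assms(2)[OF ij(1)] compact_imp_closed[OF assms(2)[OF ij(2)]]
          dis[OF ij False]] .
    then obtain d where "d > 0" "\<forall>x\<in>K i. \<forall>y\<in>K j. d \<le> dist x y" by blast
    then show ?thesis unfolding eventually_at_right_field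
      by (intro exI[of _ d]) force
  qed simp
  then have "\<forall>\<^sub>F e in at_right 0. \<forall>i\<in>J. \<forall>j\<in>J. i \<noteq> j \<longrightarrow> (\<forall>x\<in>K i. \<forall>y\<in>K j. e < dist x y)"
    using \<open>finite J\<close> by (intro eventually_ball_finite ballI) auto
  then obtain b :: real where "b > 0" and
    "\<And>e. 0 < e \<Longrightarrow> e < b \<Longrightarrow> \<forall>i\<in>J. \<forall>j\<in>J. i \<noteq> j \<longrightarrow> (\<forall>x\<in>K i. \<forall>y\<in>K j. e < dist x y)"
    unfolding eventually_at_right_field by blast
  from this(1) this(2)[of "b / 2"] show ?thesis by (intro exI[of _ "b / 2"]) simp
qed

section \<open>Horseshoes and periodic points\<close>

text \<open>The intervals are disjoint, not merely without common interior points, so that there is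
  a positive gap between them: the scale at which periodic orbits get separated. The index type is
  left open because both words and numbers serve as indices.\<close>

definition horseshoe :: "(real \<Rightarrow> real) \<Rightarrow> 'i set \<Rightarrow> ('i \<Rightarrow> real set) \<Rightarrow> bool" where
  "horseshoe g J K \<longleftrightarrow> finite J \<and> (\<forall>j\<in>J. K j \<subseteq> {0..1} \<and> (\<exists>u v. u \<le> v \<and> K j = {u..v})) \<and>
     (\<forall>i\<in>J. \<forall>j\<in>J. K i \<subseteq> g ` K j) \<and> (\<forall>i\<in>J. \<forall>j\<in>J. i \<noteq> j \<longrightarrow> K i \<inter> K j = {})"

lemma horseshoe_periodic_point:
  assumes cont: "continuous_on {0..1} g" and self: "g ` {0..1} \<subseteq> {0..1}"
    and hs: "horseshoe g J K" and w: "\<And>i. i < m \<Longrightarrow> w i \<in> J" and "0 < m"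
  shows "\<exists>x\<in>{0..1}. (g ^^ m) x = x \<and> (\<forall>i<m. (g ^^ i) x \<in> K (w i))"
proof -
  \<comment> \<open>Index \<open>m\<close> wraps round to \<open>w 0\<close>, so the final image is
    the interval where the chain starts and contains \<open>{u..v}\<close>. This yields the fixed
    point of \<open>g ^^ m\<close>.\<close>
  define I where "I i = K (w (if i = m then 0 else i))" for i
  have wJ: "w (if i = m then 0 else i) \<in> J" if "i \<le> m" for i
    using w that \<open>0 < m\<close> by auto
  have "\<exists>u v. u \<le> v \<and> (\<forall>i\<le>m. (g ^^ i) ` {u..v} \<subseteq> I i) \<and> (g ^^ m) ` {u..v} = I m"
  proof (rule covering_chain[OF cont])
    show "\<exists>c d. c \<le> d \<and> I i = {c..d}" if "i \<le> m" for i
      using hs wJ[OF that] by (auto simp: horseshoe_def I_def)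
    show "I i \<subseteq> {0..1}" if "i < m" for i
      using hs wJ[of i] that unfolding horseshoe_def I_def by auto
    show "I (Suc i) \<subseteq> g ` I i" if "i < m" for i
      using hs wJ[of i] wJ[of "Suc i"] that unfolding horseshoe_def I_def by auto
  qed
  then obtain u v where uv: "u \<le> v" "\<And>i. i \<le> m \<Longrightarrow> (g ^^ i) ` {u..v} \<subseteq> I i"
      "(g ^^ m) ` {u..v} = I m" by blast
  have sub: "{u..v} \<subseteq> I 0" using uv(2)[of 0] by simp
  then have sub1: "{u..v} \<subseteq> {0..1}"
    using hs wJ[of 0] unfolding horseshoe_def I_def by auto
  have "\<exists>x\<in>{u..v}. (g ^^ m) x = x"
  proof (rule covering_fixpoint[OF _ uv(1)])
    show "continuous_on {u..v} (g ^^ m)"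
      using continuous_on_funpow[OF cont self] sub1 continuous_on_subset by blast
    show "{u..v} \<subseteq> (g ^^ m) ` {u..v}"
      using sub \<open>0 < m\<close> unfolding uv(3) I_def by simp
  qed
  then obtain x where x: "x \<in> {u..v}" "(g ^^ m) x = x" by blast
  have "(g ^^ i) x \<in> K (w i)" if "i < m" for i
    using uv(2)[of i] x(1) that by (auto simp: I_def)
  then show ?thesis using x sub1 by blast
qed

text \<open>The growth rate is a limsup, so arbitrarily large \<open>n\<close> suffice. This matters
  because only lengths in \<open>A\<close> will be available.\<close>

lemma separated_growth_ge:
  assumes "\<And>N. \<exists>n\<ge>N. \<exists>E. E \<subseteq> X \<and> finite E \<and> E \<noteq> {} \<and> separated f n \<epsilon> E \<and>
    y \<le> ln (real (card E)) / real n"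
  shows "ereal y \<le> separated_growth f X \<epsilon>"
proof (rule ccontr)
  let ?S = "\<lambda>n. SUP E \<in> {E. E \<subseteq> X \<and> finite E \<and> E \<noteq> {} \<and> separated f n \<epsilon> E}.
       ereal (ln (real (card E)) / real n)"
  assume "\<not> ereal y \<le> separated_growth f X \<epsilon>"
  then have "limsup ?S < ereal y" unfolding separated_growth_def by simp
  then have "eventually (\<lambda>n. ?S n < ereal y) sequentially" by (rule Limsup_lessD)
  then obtain N where N: "\<And>n. n \<ge> N \<Longrightarrow> ?S n < ereal y"
    unfolding eventually_sequentially by blast
  obtain n E where n: "n \<ge> N" and E: "E \<in> {E. E \<subseteq> X \<and> finite E \<and> E \<noteq> {} \<and> separated f n \<epsilon> E}"
      "y \<le> ln (real (card E)) / real n"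
    using assms[of N] by blast
  have "ereal y \<le> ereal (ln (real (card E)) / real n)" using E(2) by simp
  also have "\<dots> \<le> ?S n" using E(1) by (rule SUP_upper)
  also have "\<dots> < ereal y" using N n by blast
  finally show False by simp
qed

lemma separated_growth_le_topological_entropy:
  assumes "X \<noteq> {}" "\<epsilon> > 0"
  shows "separated_growth f X \<epsilon> \<le> topological_entropy f X"
  using assms unfolding topological_entropy_def by (auto intro: SUP_upper)

text \<open>A period \<open>p\<close> under \<open>f\<close> is also one under
  \<open>f ^^ M\<close>, hence \<open>m dvd p\<close>. Since \<open>M dvd m\<close>, one can write
  \<open>p = M * q\<close>; then \<open>q\<close> is a period under \<open>f ^^ M\<close> as well,
  and \<open>m dvd q\<close> excludes \<open>p < M * m\<close>.\<close>

lemma periodic_word_minimal_period: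
  assumes x: "((f ^^ M) ^^ m) x = x" and "0 < M" "0 < m" "M dvd m"
    and ret: "\<And>i. 0 < i \<Longrightarrow> i < m \<Longrightarrow> ((f ^^ M) ^^ i) x \<noteq> x"
  shows "minimal_period f x (M * m)"
  unfolding minimal_period_def
proof (intro conjI allI impI notI)
  show "0 < M * m" using assms by simp
  show "(f ^^ (M * m)) x = x" using x by (simp add: funpow_mult)
  have per: "minimal_period (f ^^ M) x m"
    using x \<open>0 < m\<close> ret by (simp add: minimal_period_def)
  fix p assume p: "0 < p \<and> p < M * m" "(f ^^ p) x = x"
  have "((f ^^ p) ^^ M) x = x" by (induction M) (simp_all add: p(2))
  then have "((f ^^ M) ^^ p) x = x" by (simp add: funpow_mult mult.commute)
  then have "m dvd p" by (rule minimal_period_dvd[OF per])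
  then obtain q where q: "p = M * q" using \<open>M dvd m\<close> by (meson dvd_def dvd_trans)
  then have "((f ^^ M) ^^ q) x = x" using p(2) by (simp add: funpow_mult)
  then have "m dvd q" by (rule minimal_period_dvd[OF per])
  then show False using p(1) q by (auto dest: dvd_imp_le)
qed

text \<open>One symbol \<open>j0\<close> is a marker that occurs only at the start of a periodic
  word, so the period under \<open>f ^^ M\<close> is exactly \<open>m\<close>. The other
  \<open>m - 1\<close> letters range freely over \<open>s\<close> symbols and give
  \<open>s ^ (m - 1)\<close> separated points with minimal period in \<open>A\<close>.\<close>

lemma entropy_ge_horseshoe:
  assumes cont: "continuous_on {0..1} f" and self: "f ` {0..1} \<subseteq> {0..1}"
    and hs: "horseshoe (f ^^ M) J K" and "0 < M" and card: "card J = Suc s" and "0 < s"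
    and A: "\<And>k. 0 < k \<Longrightarrow> \<exists>n\<in>A. k dvd n" "0 \<notin> A"
  shows "ereal (ln (real s) / real M) \<le> topological_entropy f (closure (periodic_points f A))"
proof -
  define X where "X = closure (periodic_points f A)"
  define G where "G = f ^^ M"
  have G: "continuous_on {0..1} G" "G ` {0..1} \<subseteq> {0..1}"
    unfolding G_def using continuous_on_funpow[OF cont self] funpow_image_subset[OF self] by auto
  have hs': "horseshoe G J K" using hs by (simp add: G_def)
  have "finite J" using hs by (simp add: horseshoe_def)
  obtain j0 where j0: "j0 \<in> J" using card by fastforce
  have card': "card (J - {j0}) = s" using card j0 by simp
  have dis: "i \<in> J \<Longrightarrow> j \<in> J \<Longrightarrow> i \<noteq> j \<Longrightarrow> K i \<inter> K j = {}" for i j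
    using hs unfolding horseshoe_def by blast
  obtain \<epsilon> where \<epsilon>: "\<epsilon> > 0"
    "\<And>i j x y. i \<in> J \<Longrightarrow> j \<in> J \<Longrightarrow> i \<noteq> j \<Longrightarrow> x \<in> K i \<Longrightarrow> y \<in> K j \<Longrightarrow> \<epsilon> < dist x y"
  proof -
    have "compact (K j)" if "j \<in> J" for j
      using hs that unfolding horseshoe_def by (metis compact_Icc)
    from finite_disjoint_compact_gap[where K = K, OF \<open>finite J\<close> this dis] that show ?thesis by blast
  qed
  have words: "\<exists>E. E \<subseteq> periodic_points f A \<and> finite E \<and> card E = s ^ (m - 1) \<and> separated f (M * m) \<epsilon> E"
    if m: "0 < m" "M dvd m" "M * m \<in> A" for m
  proof -
    define W where "W = {ws. set ws \<subseteq> J - {j0} \<and> length ws = m - 1}"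
    have W: "finite W" "card W = s ^ (m - 1)"
      unfolding W_def using \<open>finite J\<close> card' by (simp_all add: card_lists_length_eq finite_lists_length_eq)
    have "\<exists>x\<in>{0..1}. (G ^^ m) x = x \<and> (\<forall>i<m. (G ^^ i) x \<in> K ((j0 # ws) ! i))" if "ws \<in> W" for ws
    proof (rule horseshoe_periodic_point[OF G hs' _ m(1)])
      show "(j0 # ws) ! i \<in> J" if "i < m" for i
        using that \<open>ws \<in> W\<close> j0 nth_mem[of i "j0 # ws"] by (auto simp: W_def)
    qed
    then obtain x where x: "\<And>ws. ws \<in> W \<Longrightarrow> x ws \<in> {0..1} \<and> (G ^^ m) (x ws) = x ws"
      "\<And>ws i. ws \<in> W \<Longrightarrow> i < m \<Longrightarrow> (G ^^ i) (x ws) \<in> K ((j0 # ws) ! i)" by metis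
    have per: "minimal_period f (x ws) (M * m)" if ws: "ws \<in> W" for ws
    proof (rule periodic_word_minimal_period[OF _ \<open>0 < M\<close> m(1,2)])
      show "((f ^^ M) ^^ m) (x ws) = x ws" using x(1)[OF ws] by (simp add: G_def)
      fix i assume i: "0 < i" "i < m"
      then have "ws ! (i - 1) \<in> set ws" using ws by (intro nth_mem) (auto simp: W_def)
      then have "ws ! (i - 1) \<in> J" "ws ! (i - 1) \<noteq> j0" using ws by (auto simp: W_def)
      moreover have "(G ^^ i) (x ws) \<in> K (ws ! (i - 1))" using x(2)[OF ws i(2)] i by simp
      moreover have "x ws \<in> K j0" using x(2)[OF ws m(1)] by simp
      ultimately show "((f ^^ M) ^^ i) (x ws) \<noteq> x ws" using dis j0 unfolding G_def by fastforce
    qed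
    have sep: "\<exists>i<M * m. dist ((f ^^ i) (x ws)) ((f ^^ i) (x ws')) > \<epsilon>"
      if ws: "ws \<in> W" "ws' \<in> W" "ws \<noteq> ws'" for ws ws'
    proof -
      \<comment> \<open>The marker occupies time 0, so letter \<open>i\<close> of \<open>ws\<close>
        is read at time \<open>Suc i\<close> under \<open>G\<close>, which is still below
        \<open>m\<close>.\<close>
      obtain i where i: "i < m - 1" "ws ! i \<noteq> ws' ! i"
        using ws unfolding W_def by (auto simp: list_eq_iff_nth_eq)
      have "ws ! i \<in> set ws" "ws' ! i \<in> set ws'" using ws i by (auto simp: W_def)
      then have "ws ! i \<in> J" "ws' ! i \<in> J" using ws by (auto simp: W_def)
      moreover have "(G ^^ Suc i) (x ws) \<in> K (ws ! i)" "(G ^^ Suc i) (x ws') \<in> K (ws' ! i)"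
        using x(2)[of ws "Suc i"] x(2)[of ws' "Suc i"] ws i by auto
      ultimately have "\<epsilon> < dist ((G ^^ Suc i) (x ws)) ((G ^^ Suc i) (x ws'))"
        using \<epsilon>(2) i(2) by blast
      then have "\<epsilon> < dist ((f ^^ (M * Suc i)) (x ws)) ((f ^^ (M * Suc i)) (x ws'))"
        unfolding G_def funpow_mult .
      moreover have "M * Suc i < M * m" using i \<open>0 < M\<close> by (intro mult_strict_left_mono) auto
      ultimately show ?thesis by blast
    qed
    have "inj_on x W"
    proof (rule inj_onI, rule ccontr)
      fix ws ws' assume "ws \<in> W" "ws' \<in> W" "x ws = x ws'" "ws \<noteq> ws'"
      with sep[of ws ws'] \<epsilon>(1) show False by simp
    qed
    then have "card (x ` W) = s ^ (m - 1)" using W by (simp add: card_image)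
    moreover have "separated f (M * m) \<epsilon> (x ` W)" unfolding separated_def using sep by blast
    moreover have "x ` W \<subseteq> periodic_points f A"
      using x(1) per m(3) by (auto simp: periodic_points_def)
    ultimately show ?thesis using W(1) by blast
  qed
  have main: "ereal y \<le> separated_growth f X \<epsilon>" if y: "y < ln (real s) / real M" for y
  proof (rule separated_growth_ge)
    fix N
    \<comment> \<open>The letter spent on the marker costs the factor \<open>(m - 1) / m\<close>,
      which tends to 1.\<close>
    have "(\<lambda>m. ln (real s) / real M - (ln (real s) / real M) / real m) \<longlonglongrightarrow> ln (real s) / real M - 0"
      by (intro tendsto_diff tendsto_const lim_const_over_n)
    then have "eventually (\<lambda>m. y < ln (real s) / real M - (ln (real s) / real M) / real m) sequentially"
      using y by (intro order_tendstoD) auto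
    then obtain m0 where m0: "\<And>m. m \<ge> m0 \<Longrightarrow> y < ln (real s) / real M - (ln (real s) / real M) / real m"
      unfolding eventually_sequentially by blast
    \<comment> \<open>A multiple \<open>n\<close> of \<open>M * M * k\<close> in \<open>A\<close>
      makes \<open>m = n / M\<close> divisible by \<open>M\<close> and at least \<open>k\<close>,
      which puts \<open>m\<close> beyond \<open>m0\<close> and \<open>n\<close> beyond
      \<open>N\<close>.\<close>
    define k where "k = Suc (max m0 N)"
    obtain n where n: "n \<in> A" "M * M * k dvd n"
      using A(1)[of "M * M * k"] \<open>0 < M\<close> by (auto simp: k_def)
    from n(2) obtain q where q: "n = M * M * k * q" by (rule dvdE)
    define m where "m = M * k * q"
    have "0 < n" using n A(2) by (cases n) auto
    then have m: "0 < m" "M dvd m" "n = M * m" "k \<le> m" using q by (auto simp: m_def)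
    obtain E where E: "E \<subseteq> periodic_points f A" "finite E" "card E = s ^ (m - 1)" "separated f n \<epsilon> E"
      using words[OF m(1,2)] n(1) m(3) by auto
    have "k \<le> n" using m \<open>0 < M\<close> by (metis dvd_imp_le dvd_triv_right le_trans \<open>0 < n\<close>)
    then have "n \<ge> N" by (simp add: k_def)
    moreover have "E \<noteq> {}" using E(3) \<open>0 < s\<close> by auto
    moreover have "y \<le> ln (real (card E)) / real n"
    proof -
      have "ln (real (card E)) / real n = real (m - 1) * ln (real s) / (real M * real m)"
        using \<open>0 < s\<close> m by (simp add: E(3) ln_realpow)
      also have "\<dots> = ln (real s) / real M - (ln (real s) / real M) / real m"
        using m(1) \<open>0 < M\<close> by (simp add: of_nat_diff field_simps)
      finally have eq: "ln (real (card E)) / real n = \<dots>" .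
      have "m0 \<le> m" using m(4) by (simp add: k_def)
      from m0[OF this] show ?thesis unfolding eq by (rule less_imp_le)
    qed
    moreover have "E \<subseteq> X" using E(1) closure_subset unfolding X_def by blast
    ultimately show "\<exists>n\<ge>N. \<exists>E. E \<subseteq> X \<and> finite E \<and> E \<noteq> {} \<and> separated f n \<epsilon> E \<and>
        y \<le> ln (real (card E)) / real n" using E(2,4) by blast
  qed
  \<comment> \<open>The entropy of the empty set is 0 by convention and not a supremum of growth
    rates, so this case is excluded first: its growth rate would be \<open>-\<infinity>\<close>,
    against \<open>main\<close>.\<close>
  have "X \<noteq> {}"
  proof
    assume "X = {}"
    then have "{E. E \<subseteq> X \<and> finite E \<and> E \<noteq> {} \<and> separated f n \<epsilon> E} = {}" for n by auto
    then have "separated_growth f X \<epsilon> = - \<infinity>"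
      unfolding separated_growth_def by (simp only: image_empty Sup_empty bot_ereal_def) (simp add: Limsup_const)
    moreover have "ereal (ln (real s) / real M - 1) \<le> separated_growth f X \<epsilon>" by (rule main) simp
    ultimately show False by simp
  qed
  have "ereal (ln (real s) / real M) \<le> separated_growth f X \<epsilon>"
  proof (rule ccontr)
    assume "\<not> ereal (ln (real s) / real M) \<le> separated_growth f X \<epsilon>"
    then obtain y where "separated_growth f X \<epsilon> < ereal y" "ereal y < ereal (ln (real s) / real M)"
      using ereal_dense2 not_le by meson
    then show False using main[of y] by simp
  qed
  also have "\<dots> \<le> topological_entropy f X"
    by (rule separated_growth_le_topological_entropy[OF \<open>X \<noteq> {}\<close> \<epsilon>(1)])
  finally show ?thesis unfolding X_def .
qed

section \<open>Counting words of an automaton that forgets its past\<close>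

text \<open>Abstract model of words of cells: states are intervals, letters are cells, live states
  are the nonempty ones, and \<open>B\<close> consists of the full cells. One number
  \<open>\<theta>\<close> bounds both the branching into live states outside \<open>B\<close> and
  the growth of loops at base states; live words then grow like \<open>\<theta> ^ n\<close> up to a
  polynomial factor.\<close>

locale renewal_automaton =
  fixes \<Sigma> :: "'a set" and step :: "'q \<Rightarrow> 'a \<Rightarrow> 'q" and Q B :: "'q set"
    and live :: "'q \<Rightarrow> bool" and \<theta> :: nat
  assumes finite_alphabet: "finite \<Sigma>" and finite_base: "finite B" and base_subset: "B \<subseteq> Q"
    and step_closed: "q \<in> Q \<Longrightarrow> a \<in> \<Sigma> \<Longrightarrow> step q a \<in> Q"
    and live_step: "live (step q a) \<Longrightarrow> live q"
    and card_nonbase_step: "q \<in> Q \<Longrightarrow> card {a \<in> \<Sigma>. live (step q a) \<and> step q a \<notin> B} \<le> \<theta>"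
    and card_loops: "p \<in> B \<Longrightarrow> card {ws. set ws \<subseteq> \<Sigma> \<and> length ws = n \<and> foldl step p ws = p} \<le> \<theta> ^ n"
    and theta_pos: "0 < \<theta>"
begin

text \<open>The start is exempt from the condition, so a word may begin at a state of
  \<open>T\<close>. The counting starts with \<open>T = B\<close> and removes base states from
  \<open>T\<close> until none is left.\<close>

definition avoiding :: "'q set \<Rightarrow> 'q \<Rightarrow> nat \<Rightarrow> 'a list set" where
  "avoiding T q n = {ws. (set ws \<subseteq> \<Sigma> \<and> length ws = n) \<and> live (foldl step q ws) \<and>
     (\<forall>i. 0 < i \<and> i \<le> n \<longrightarrow> foldl step q (take i ws) \<notin> T)}"

lemma finite_avoiding: "finite (avoiding T q n)"
  unfolding avoiding_def
  by (rule finite_subset[OF _ finite_lists_length_eq[OF finite_alphabet, of n]]) blast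

lemma finite_loops: "finite {ws. set ws \<subseteq> \<Sigma> \<and> length ws = n \<and> foldl step p ws = p}"
  by (rule finite_subset[OF _ finite_lists_length_eq[OF finite_alphabet, of n]]) blast

lemma live_foldl: "live (foldl step q ws) \<Longrightarrow> live q"
  by (induction ws arbitrary: q) (auto dest: live_step)

lemma live_foldl_take: "live (foldl step q ws) \<Longrightarrow> live (foldl step q (take i ws))"
  using live_foldl[of "foldl step q (take i ws)" "drop i ws"] by (simp flip: foldl_append)

text \<open>Every letter leads to a live state outside \<open>B\<close>, which leaves at most
  \<open>\<theta>\<close> choices at each step.\<close>

lemma card_avoiding_base: "q \<in> Q \<Longrightarrow> card (avoiding B q n) \<le> \<theta> ^ n"
proof (induction n arbitrary: q)
  case 0
  have "avoiding B q 0 \<subseteq> {[]}" by (auto simp: avoiding_def)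
  then have "card (avoiding B q 0) \<le> card {[] :: 'a list}" by (intro card_mono) auto
  then show ?case by simp
next
  case (Suc n)
  define R where "R = {a \<in> \<Sigma>. live (step q a) \<and> step q a \<notin> B}"
  have R: "finite R" "card R \<le> \<theta>"
    using finite_alphabet card_nonbase_step[OF Suc.prems] by (auto simp: R_def)
  have "avoiding B q (Suc n) \<subseteq> (\<Union>a\<in>R. (#) a ` avoiding B (step q a) n)"
  proof
    fix ws assume ws: "ws \<in> avoiding B q (Suc n)"
    then obtain a vs where eq: "ws = a # vs" by (cases ws) (auto simp: avoiding_def)
    have *: "foldl step q (take i ws) \<notin> B" if "0 < i" "i \<le> Suc n" for i
      using ws that by (auto simp: avoiding_def)
    have lv: "live (foldl step (step q a) vs)" and \<Sigma>: "a \<in> \<Sigma>" "set vs \<subseteq> \<Sigma>" "length vs = n"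
      using ws eq by (auto simp: avoiding_def)
    have "foldl step (step q a) (take i vs) \<notin> B" if "i \<le> n" for i
      using *[of "Suc i"] that eq by simp
    from this this[of 0] have "step q a \<notin> B" "vs \<in> avoiding B (step q a) n"
      using lv \<Sigma> by (simp_all add: avoiding_def)
    then show "ws \<in> (\<Union>a\<in>R. (#) a ` avoiding B (step q a) n)"
      using eq \<Sigma> live_foldl[OF lv] by (auto simp: R_def)
  qed
  then have "card (avoiding B q (Suc n)) \<le> card (\<Union>a\<in>R. (#) a ` avoiding B (step q a) n)"
    using R finite_avoiding by (intro card_mono) auto
  also have "\<dots> \<le> (\<Sum>a\<in>R. card ((#) a ` avoiding B (step q a) n))"
    by (rule card_UN_le[OF R(1)])
  also have "\<dots> \<le> (\<Sum>a\<in>R. \<theta> ^ n)"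
  proof (rule sum_mono)
    fix a assume "a \<in> R"
    then have "step q a \<in> Q" using Suc.prems step_closed by (auto simp: R_def)
    then show "card ((#) a ` avoiding B (step q a) n) \<le> \<theta> ^ n"
      using Suc.IH card_image_le[OF finite_avoiding] le_trans by blast
  qed
  also have "\<dots> \<le> \<theta> ^ Suc n" using R(2) by simp
  finally show ?case .
qed

text \<open>Splitting a word at its last visit to \<open>p\<close>.\<close>

lemma avoiding_from_subset:
  "avoiding (T - {p}) p n \<subseteq>
     (\<Union>j\<in>{..n}. (\<lambda>(v, x). v @ x) `
       ({ws. set ws \<subseteq> \<Sigma> \<and> length ws = j \<and> foldl step p ws = p} \<times> avoiding T p (n - j)))"
proof
  fix ws assume ws: "ws \<in> avoiding (T - {p}) p n"
  define P where "P j \<longleftrightarrow> j \<le> n \<and> foldl step p (take j ws) = p" for j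
  \<comment> \<open>Time 0 counts as a visit because the word starts at \<open>p\<close>, so a last
    visit always exists.\<close>
  define j where "j = (GREATEST j. P j)"
  have "P 0" by (simp add: P_def)
  then have Pj: "P j" unfolding j_def by (rule GreatestI_nat[where b = n]) (simp add: P_def)
  have mx: "i \<le> j" if "P i" for i
    unfolding j_def using that by (rule Greatest_le_nat[where b = n]) (simp add: P_def)
  have len: "length ws = n" "set ws \<subseteq> \<Sigma>" using ws by (auto simp: avoiding_def)
  have run: "foldl step p (take i (drop j ws)) = foldl step p (take (j + i) ws)" for i
    using Pj by (simp add: P_def take_add)
  have "foldl step p (drop j ws) = foldl step p ws"
    using run[of "n - j"] len Pj by (simp add: P_def)
  moreover have "foldl step p (take i (drop j ws)) \<notin> T" if "0 < i" "i \<le> n - j" for i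
  proof -
    have "foldl step p (take (j + i) ws) \<notin> T - {p}" using ws that by (auto simp: avoiding_def)
    moreover have "\<not> P (j + i)" using mx[of "j + i"] that by auto
    ultimately show ?thesis using that run[of i] by (auto simp: P_def)
  qed
  moreover have "live (foldl step p ws)" using ws by (simp add: avoiding_def)
  ultimately have "drop j ws \<in> avoiding T p (n - j)"
    using len set_drop_subset[of j ws] by (auto simp: avoiding_def)
  moreover have "take j ws \<in> {ws. set ws \<subseteq> \<Sigma> \<and> length ws = j \<and> foldl step p ws = p}"
    using Pj len set_take_subset[of j ws] by (auto simp: P_def)
  ultimately have "ws \<in> (\<lambda>(v, x). v @ x) `
       ({ws. set ws \<subseteq> \<Sigma> \<and> length ws = j \<and> foldl step p ws = p} \<times> avoiding T p (n - j))"
    by (intro image_eqI[of _ _ "(take j ws, drop j ws)"]) auto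
  then show "ws \<in> (\<Union>j\<in>{..n}. (\<lambda>(v, x). v @ x) `
       ({ws. set ws \<subseteq> \<Sigma> \<and> length ws = j \<and> foldl step p ws = p} \<times> avoiding T p (n - j)))"
    using Pj by (auto simp: P_def)
qed

text \<open>Splitting a word at its first visit to \<open>p\<close>.\<close>

lemma avoiding_to_subset:
  "avoiding (T - {p}) q n \<subseteq> avoiding T q n \<union>
     (\<Union>i\<in>{..<n}. (\<lambda>((u, c), x). u @ c # x) ` ((avoiding T q i \<times> \<Sigma>) \<times> avoiding (T - {p}) p (n - Suc i)))"
proof
  fix ws assume ws: "ws \<in> avoiding (T - {p}) q n"
  have len: "length ws = n" "set ws \<subseteq> \<Sigma>" and lv: "live (foldl step q ws)"
    and av: "\<And>i. 0 < i \<Longrightarrow> i \<le> n \<Longrightarrow> foldl step q (take i ws) \<notin> T - {p}"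
    using ws by (auto simp: avoiding_def)
  show "ws \<in> avoiding T q n \<union>
     (\<Union>i\<in>{..<n}. (\<lambda>((u, c), x). u @ c # x) ` ((avoiding T q i \<times> \<Sigma>) \<times> avoiding (T - {p}) p (n - Suc i)))"
  proof (cases "ws \<in> avoiding T q n")
    case False
    \<comment> \<open>The index is that of the letter leading to \<open>p\<close>, so the visit
      takes place at time \<open>Suc i\<close> and the prefix of length \<open>i\<close> avoids all
      of \<open>T\<close>.\<close>
    define P where "P i \<longleftrightarrow> i < n \<and> foldl step q (take (Suc i) ws) = p" for i
    obtain j where "0 < j" "j \<le> n" "foldl step q (take j ws) \<in> T"
      using False len lv by (auto simp: avoiding_def)
    then have "P (j - 1)" using av[of j] by (auto simp: P_def)
    define i where "i = (LEAST i. P i)"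
    have Pi: "P i" unfolding i_def using \<open>P (j - 1)\<close> by (rule LeastI)
    have mn: "\<not> P k" if "k < i" for k using that not_less_Least unfolding i_def by blast
    have i: "i < n" "foldl step q (take (Suc i) ws) = p" using Pi by (auto simp: P_def)
    have "foldl step q (take k ws) \<notin> T" if "0 < k" "k \<le> i" for k
      using av[of k] mn[of "k - 1"] that i by (auto simp: P_def)
    then have u: "take i ws \<in> avoiding T q i"
      using len i live_foldl_take[OF lv] set_take_subset[of i ws]
      by (auto simp: avoiding_def min_def)
    have run: "foldl step p (take k (drop (Suc i) ws)) = foldl step q (take (Suc i + k) ws)" for k
      by (simp only: take_add foldl_append i(2))
    have "foldl step p (drop (Suc i) ws) = foldl step q ws"
      using run[of "n - Suc i"] len i by simp
    moreover have "foldl step p (take k (drop (Suc i) ws)) \<notin> T - {p}" if "0 < k" "k \<le> n - Suc i" for k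
      unfolding run using av[of "Suc i + k"] that i by auto
    ultimately have x: "drop (Suc i) ws \<in> avoiding (T - {p}) p (n - Suc i)"
      using len lv set_drop_subset[of "Suc i" ws] unfolding avoiding_def by auto
    have "ws ! i \<in> \<Sigma>" using len i nth_mem[of i ws] by auto
    then have "ws \<in> (\<lambda>((u, c), x). u @ c # x) `
        ((avoiding T q i \<times> \<Sigma>) \<times> avoiding (T - {p}) p (n - Suc i))"
      using u x i(1) len
      by (intro image_eqI[of _ _ "((take i ws, ws ! i), drop (Suc i) ws)"]) (auto simp: id_take_nth_drop)
    then show ?thesis using i(1) by blast
  qed simp
qed

text \<open>Up to its last visit to \<open>p\<close> the word is a loop, counted by
  \<open>card_loops\<close>; the rest avoids \<open>T\<close>. The powers of \<open>\<theta>\<close>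
  combine to \<open>\<theta> ^ n\<close>, and the \<open>n + 1\<close> possible positions raise the
  degree by one.\<close>

lemma card_avoiding_from_le:
  assumes bd: "\<And>n. card (avoiding T p n) \<le> C * (n + 1) ^ k * \<theta> ^ n" and "p \<in> B"
  shows "card (avoiding (T - {p}) p n) \<le> C * (n + 1) ^ Suc k * \<theta> ^ n"
proof -
  let ?L = "\<lambda>j. {ws. set ws \<subseteq> \<Sigma> \<and> length ws = j \<and> foldl step p ws = p}"
  let ?I = "\<lambda>j. (\<lambda>(v, x). v @ x) ` (?L j \<times> avoiding T p (n - j))"
  have fin: "finite (?L j \<times> avoiding T p (n - j))" for j
    using finite_loops finite_avoiding by blast
  have "card (avoiding (T - {p}) p n) \<le> card (\<Union>j\<in>{..n}. ?I j)"
    by (intro card_mono avoiding_from_subset finite_UN_I finite_imageI fin) auto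
  also have "\<dots> \<le> (\<Sum>j\<le>n. card (?I j))" by (rule card_UN_le) simp
  also have "\<dots> \<le> (\<Sum>j\<le>n. C * (n + 1) ^ k * \<theta> ^ n)"
  proof (rule sum_mono)
    fix j assume j: "j \<in> {..n}"
    have "card (?I j) \<le> card (?L j) * card (avoiding T p (n - j))"
      using card_image_le[OF fin] by (simp add: card_cartesian_product)
    also have "\<dots> \<le> \<theta> ^ j * (C * (n - j + 1) ^ k * \<theta> ^ (n - j))"
      by (intro mult_le_mono card_loops bd \<open>p \<in> B\<close>)
    also have "\<dots> \<le> \<theta> ^ j * (C * (n + 1) ^ k * \<theta> ^ (n - j))"
      by (intro mult_le_mono power_mono order_refl) auto
    also have "\<dots> = C * (n + 1) ^ k * \<theta> ^ n"
      using j by (simp add: power_add[symmetric] mult.left_commute[of "\<theta> ^ j"])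
    finally show "card (?I j) \<le> C * (n + 1) ^ k * \<theta> ^ n" .
  qed
  also have "\<dots> = C * (n + 1) ^ Suc k * \<theta> ^ n" by (simp add: algebra_simps)
  finally show ?thesis .
qed

text \<open>Words that never visit \<open>p\<close> contribute the term \<open>C\<close>. The others
  split into a prefix avoiding \<open>T\<close>, a letter and a word starting at \<open>p\<close>:
  the degrees \<open>k\<close> and \<open>k + 1\<close> add up, and the sum over positions adds one
  more.\<close>

lemma card_avoiding_le:
  assumes bd: "\<And>q n. q \<in> Q \<Longrightarrow> card (avoiding T q n) \<le> C * (n + 1) ^ k * \<theta> ^ n"
    and "p \<in> B" "q \<in> Q"
  shows "card (avoiding (T - {p}) q n) \<le> (C + card \<Sigma> * C * C) * (n + 1) ^ (2 * k + 2) * \<theta> ^ n"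
proof -
  let ?I = "\<lambda>i. (\<lambda>((u, c), x). u @ c # x) ` ((avoiding T q i \<times> \<Sigma>) \<times> avoiding (T - {p}) p (n - Suc i))"
  have fin: "finite ((avoiding T q i \<times> \<Sigma>) \<times> avoiding (T - {p}) p (n - Suc i))" for i
    using finite_alphabet finite_avoiding by blast
  have from_p: "card (avoiding (T - {p}) p n) \<le> C * (n + 1) ^ Suc k * \<theta> ^ n" for n
    using assms(2) base_subset by (intro card_avoiding_from_le bd) auto
  have "card (avoiding (T - {p}) q n) \<le> card (avoiding T q n \<union> (\<Union>i\<in>{..<n}. ?I i))"
    by (intro card_mono avoiding_to_subset finite_UnI finite_avoiding finite_UN_I finite_imageI fin) auto
  also have "\<dots> \<le> card (avoiding T q n) + card (\<Union>i\<in>{..<n}. ?I i)" by (rule card_Un_le)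
  also have "\<dots> \<le> C * (n + 1) ^ k * \<theta> ^ n + (\<Sum>i<n. card (?I i))"
    by (intro add_mono bd \<open>q \<in> Q\<close> card_UN_le) simp
  also have "(\<Sum>i<n. card (?I i)) \<le> (\<Sum>i<n. card \<Sigma> * C * C * (n + 1) ^ (2 * k + 1) * \<theta> ^ n)"
  proof (rule sum_mono)
    fix i assume "i \<in> {..<n}"
    then have i: "i < n" by simp
    have "card (?I i) \<le> (card (avoiding T q i) * card \<Sigma>) * card (avoiding (T - {p}) p (n - Suc i))"
      using card_image_le[OF fin] by (simp only: card_cartesian_product)
    also have "\<dots> \<le> ((C * (i + 1) ^ k * \<theta> ^ i) * card \<Sigma>) *
        (C * (n - Suc i + 1) ^ Suc k * \<theta> ^ (n - Suc i))"
      by (intro mult_le_mono order_refl bd from_p \<open>q \<in> Q\<close>)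
    \<comment> \<open>The letter entering \<open>p\<close> has used up one step; enlarging the
      exponent \<open>n - Suc i\<close> to \<open>n - i\<close> restores the full
      \<open>\<theta> ^ n\<close>.\<close>
    also have "\<dots> \<le> ((C * (n + 1) ^ k * \<theta> ^ i) * card \<Sigma>) * (C * (n + 1) ^ Suc k * \<theta> ^ (n - i))"
      using i theta_pos by (intro mult_le_mono power_mono power_increasing order_refl) auto
    also have "\<dots> = card \<Sigma> * C * C * ((n + 1) ^ k * (n + 1) ^ Suc k) * (\<theta> ^ i * \<theta> ^ (n - i))"
      by (simp only: mult_ac)
    also have "\<dots> = card \<Sigma> * C * C * (n + 1) ^ (2 * k + 1) * \<theta> ^ n"
      using i by (simp only: power_add[symmetric]) (simp add: mult_2)
    finally show "card (?I i) \<le> card \<Sigma> * C * C * (n + 1) ^ (2 * k + 1) * \<theta> ^ n" .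
  qed
  also have "\<dots> = n * (card \<Sigma> * C * C * (n + 1) ^ (2 * k + 1) * \<theta> ^ n)" by simp
  also have "\<dots> \<le> (n + 1) * (card \<Sigma> * C * C * (n + 1) ^ (2 * k + 1) * \<theta> ^ n)"
    by (intro mult_le_mono) auto
  also have "\<dots> = card \<Sigma> * C * C * (n + 1) ^ (2 * k + 2) * \<theta> ^ n" by (simp add: algebra_simps)
  also have "C * (n + 1) ^ k * \<theta> ^ n \<le> C * (n + 1) ^ (2 * k + 2) * \<theta> ^ n"
    by (intro mult_le_mono power_increasing order_refl) (use theta_pos in auto)
  finally show ?thesis by (simp add: algebra_simps)
qed

text \<open>Base states are released from the avoided set one at a time, each at the price of a
  polynomial factor. Once the set is empty, all live words are counted.\<close>

lemma card_live_words_le: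
  "\<exists>C k. \<forall>q\<in>Q. \<forall>n. card {ws. (set ws \<subseteq> \<Sigma> \<and> length ws = n) \<and> live (foldl step q ws)}
     \<le> C * (n + 1) ^ k * \<theta> ^ n"
proof -
  have "\<exists>C k. \<forall>q\<in>Q. \<forall>n. card (avoiding (B - S) q n) \<le> C * (n + 1) ^ k * \<theta> ^ n" if "finite S" "S \<subseteq> B" for S
    using that
  proof (induction S rule: finite_induct)
    case empty
    show ?case using card_avoiding_base by (intro exI[of _ 1] exI[of _ 0]) auto
  next
    case (insert p S)
    then obtain C k where "\<And>q n. q \<in> Q \<Longrightarrow> card (avoiding (B - S) q n) \<le> C * (n + 1) ^ k * \<theta> ^ n"
      by auto
    from card_avoiding_le[OF this, of p] insert.prems show ?case
      by (metis Diff_insert insert_subset)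
  qed
  from this[OF finite_base order_refl] show ?thesis by (simp add: avoiding_def)
qed

end

section \<open>Words of cells\<close>

definition cell :: "nat \<Rightarrow> nat \<Rightarrow> real set" where
  "cell r a = {real a / real r..(real a + 1) / real r}"

text \<open>The minimum puts the right end point \<open>y = 1\<close> into the last cell.\<close>

definition cell_index :: "nat \<Rightarrow> real \<Rightarrow> nat" where
  "cell_index r y = min (r - 1) (nat \<lfloor>real r * y\<rfloor>)"

text \<open>Folding along a word gives the final positions of all points of the initial set whose
  orbits visit the prescribed cells. Once the fold is a full cell, the earlier letters have no
  further influence.\<close>

definition cell_step :: "(real \<Rightarrow> real) \<Rightarrow> nat \<Rightarrow> real set \<Rightarrow> nat \<Rightarrow> real set" where
  "cell_step g r I a = g ` I \<inter> cell r a"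

section \<open>Size, overlap and disjointness of cells\<close>

lemma mem_cell_iff: "0 < r \<Longrightarrow> x \<in> cell r a \<longleftrightarrow> real a \<le> real r * x \<and> real r * x \<le> real a + 1"
  by (auto simp: cell_def field_simps)

lemma cell_subset: "a < r \<Longrightarrow> cell r a \<subseteq> {0..1}"
  by (auto simp: cell_def field_simps intro: order_trans)

lemma cell_index_less: "0 < r \<Longrightarrow> cell_index r y < r"
  by (auto simp: cell_index_def)

lemma mem_cell_index:
  assumes "0 < r" "y \<in> {0..1}"
  shows "y \<in> cell r (cell_index r y)"
proof -
  have *: "0 \<le> real r * y" "real r * y \<le> real r" using assms by (auto intro: mult_left_le)
  show ?thesis
  proof (cases "nat \<lfloor>real r * y\<rfloor> \<le> r - 1")
    case True
    then show ?thesis using * assms(1) unfolding mem_cell_iff[OF assms(1)] cell_index_def min_def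
      by simp
  next
    case False
    then have "r \<le> nat \<lfloor>real r * y\<rfloor>" using assms(1) by linarith
    then have "real r \<le> real r * y" using * by linarith
    then show ?thesis using * False assms(1) unfolding mem_cell_iff[OF assms(1)] cell_index_def min_def
      by (simp add: of_nat_diff)
  qed
qed

lemma dist_cell_le:
  assumes "0 < r" "x \<in> cell r a" "y \<in> cell r a"
  shows "dist x y \<le> 1 / real r"
proof -
  have "(real a + 1) / real r = real a / real r + 1 / real r" by (simp add: add_divide_distrib)
  then show ?thesis using assms(2,3) by (auto simp: cell_def dist_real_def abs_le_iff)
qed

text \<open>Neighbouring cells share an end point, but distinct indices of equal parity differ by at
  least two.\<close>

lemma cell_disjoint:
  assumes "0 < r" "a mod 2 = b mod 2" "a \<noteq> b"
  shows "cell r a \<inter> cell r b = {}"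
proof -
  have "a + 2 \<le> b \<or> b + 2 \<le> a" using assms(2,3) by presburger
  then show ?thesis using assms(1) by (auto simp: mem_cell_iff)
qed

lemma card_cells_containing_le: "0 < r \<Longrightarrow> card {a. c \<in> cell r a} \<le> 2"
proof -
  assume r: "0 < r"
  define t where "t = nat \<lfloor>real r * c\<rfloor>"
  have "{a. c \<in> cell r a} \<subseteq> {t - 1, t}"
  proof
    fix a assume "a \<in> {a. c \<in> cell r a}"
    then have "real a \<le> real r * c" "real r * c \<le> real a + 1" using mem_cell_iff[OF r] by auto
    then have "a \<le> t" "t \<le> a + 1" unfolding t_def by linarith+
    then show "a \<in> {t - 1, t}" by auto
  qed
  from card_mono[OF _ this] show ?thesis by (simp add: card_insert_if split: if_splits)
qed

text \<open>A cell that meets \<open>{c..d}\<close> and contains neither end point lies inside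
  \<open>{c..d}\<close>, so the intersection is a full cell. The exceptions contain \<open>c\<close>
  or \<open>d\<close>, and a point lies in at most two cells.\<close>

lemma card_nonbase_cell_step:
  assumes "0 < r" "c \<le> d"
  shows "card {a \<in> {..<r}. {c..d} \<inter> cell r a \<noteq> {} \<and> {c..d} \<inter> cell r a \<notin> cell r ` {..<r}} \<le> 4"
proof -
  let ?S = "\<lambda>c. {a \<in> {..<r}. c \<in> cell r a}"
  have S: "card (?S c) \<le> 2" for c
  proof -
    have "finite {a. c \<in> cell r a}"
    proof (rule finite_subset)
      show "{a. c \<in> cell r a} \<subseteq> {..nat \<lceil>real r * c\<rceil>}"
        using mem_cell_iff[OF assms(1)] by (auto simp: le_nat_iff) linarith
    qed simp
    then have "card (?S c) \<le> card {a. c \<in> cell r a}" by (intro card_mono) auto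
    then show ?thesis using card_cells_containing_le[OF assms(1), of c] by simp
  qed
  have "{a \<in> {..<r}. {c..d} \<inter> cell r a \<noteq> {} \<and> {c..d} \<inter> cell r a \<notin> cell r ` {..<r}} \<subseteq> ?S c \<union> ?S d"
  proof (rule subsetI, rule ccontr)
    fix a assume a: "a \<in> {a \<in> {..<r}. {c..d} \<inter> cell r a \<noteq> {} \<and> {c..d} \<inter> cell r a \<notin> cell r ` {..<r}}"
      and "a \<notin> ?S c \<union> ?S d"
    then have "c \<notin> cell r a" "d \<notin> cell r a" "{c..d} \<inter> cell r a \<noteq> {}" by auto
    then have "{c..d} \<inter> cell r a = cell r a" by (auto simp: cell_def)
    then show False using a by auto
  qed
  then have "card {a \<in> {..<r}. {c..d} \<inter> cell r a \<noteq> {} \<and> {c..d} \<inter> cell r a \<notin> cell r ` {..<r}}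
      \<le> card (?S c \<union> ?S d)" by (intro card_mono) auto
  also have "\<dots> \<le> card (?S c) + card (?S d)" by (rule card_Un_le)
  also have "\<dots> \<le> 4" using S[of c] S[of d] by simp
  finally show ?thesis .
qed

text \<open>The empty set serves as the dead state; one-point intervals arise when an image only
  touches a cell.\<close>

definition cell_states :: "real set set" where
  "cell_states = {I. I = {} \<or> (\<exists>c d. 0 \<le> c \<and> c \<le> d \<and> d \<le> 1 \<and> I = {c..d})}"

lemma image_cell_state:
  fixes g :: "real \<Rightarrow> real"
  assumes "continuous_on {0..1} g" "g ` {0..1} \<subseteq> {0..1::real}" "I \<in> cell_states" "I \<noteq> {}"
  shows "\<exists>c d. 0 \<le> c \<and> c \<le> d \<and> d \<le> 1 \<and> g ` I = {c..d}"
proof -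
  obtain c d where I: "0 \<le> c" "c \<le> d" "d \<le> 1" "I = {c..d}" using assms by (auto simp: cell_states_def)
  then obtain c' d' where "g ` I = {c'..d'}" "c' \<le> d'"
    using continuous_image_closed_interval[of c d g] continuous_on_subset[OF assms(1), of "{c..d}"] by auto
  moreover have "g ` I \<subseteq> {0..1}"
    using image_mono[of I "{0..1}" g] assms(2) I by (meson atLeastatMost_subset_iff order_trans)
  ultimately show ?thesis by (metis atLeastatMost_subset_iff)
qed

lemma cell_step_closed:
  fixes g :: "real \<Rightarrow> real"
  assumes "continuous_on {0..1} g" "g ` {0..1} \<subseteq> {0..1::real}" "I \<in> cell_states"
  shows "cell_step g r I a \<in> cell_states"
proof (cases "I = {}")
  case False
  then obtain c d where "0 \<le> c" "d \<le> 1" "g ` I = {c..d}"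
    using image_cell_state[OF assms] by auto
  then show ?thesis by (auto simp: cell_step_def cell_states_def cell_def)
qed (simp add: cell_step_def cell_states_def)

lemma foldl_cell_step_closed:
  fixes g :: "real \<Rightarrow> real"
  assumes "continuous_on {0..1} g" "g ` {0..1} \<subseteq> {0..1::real}" "I \<in> cell_states"
  shows "foldl (cell_step g r) I ws \<in> cell_states"
  using assms(3) by (induction ws arbitrary: I) (auto intro: cell_step_closed[OF assms(1,2)])

lemma cell_in_cell_states: "a < r \<Longrightarrow> cell r a \<in> cell_states"
  using cell_subset[of a r] by (auto simp: cell_states_def cell_def divide_right_mono)

lemma foldl_cell_step_empty [simp]: "foldl (cell_step g r) {} ws = {}"
  by (induction ws) (auto simp: cell_step_def)

lemma funpow_mem_foldl_cell_step:
  "x \<in> I \<Longrightarrow> (\<And>i. i < length ws \<Longrightarrow> (g ^^ Suc i) x \<in> cell r (ws ! i)) \<Longrightarrow>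
    (g ^^ length ws) x \<in> foldl (cell_step g r) I ws"
proof (induction ws arbitrary: x I)
  case (Cons a ws)
  have "g x \<in> cell_step g r I a" using Cons.prems(1) Cons.prems(2)[of 0] by (auto simp: cell_step_def)
  moreover have "(g ^^ Suc i) (g x) \<in> cell r (ws ! i)" if "i < length ws" for i
    using Cons.prems(2)[of "Suc i"] that by (simp add: funpow_swap1)
  ultimately have "(g ^^ length ws) (g x) \<in> foldl (cell_step g r) (cell_step g r I a) ws"
    by (rule Cons.IH)
  then show ?case by (simp add: funpow_swap1)
qed simp

text \<open>The automaton with the full cells as base states. The bound
  \<open>4 \<le> \<theta>\<close> covers the at most four cells cut by the ends of an image
  interval.\<close>

lemma card_cell_words_le:
  fixes g :: "real \<Rightarrow> real"
  assumes cont: "continuous_on {0..1} g" and self: "g ` {0..1} \<subseteq> {0..1::real}" and "0 < r" "4 \<le> \<theta>"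
    and loops: "\<And>a t. a < r \<Longrightarrow>
      card {ws. set ws \<subseteq> {..<r} \<and> length ws = t \<and> foldl (cell_step g r) (cell r a) ws = cell r a} \<le> \<theta> ^ t"
  shows "\<exists>C k. \<forall>a<r. \<forall>n. card {ws. (set ws \<subseteq> {..<r} \<and> length ws = n) \<and>
      foldl (cell_step g r) (cell r a) ws \<noteq> {}} \<le> C * (n + 1) ^ k * \<theta> ^ n"
proof -
  interpret renewal_automaton "{..<r}" "cell_step g r" cell_states "cell r ` {..<r}" "\<lambda>I. I \<noteq> {}" \<theta>
  proof
    show "cell r ` {..<r} \<subseteq> cell_states" using cell_in_cell_states by auto
    show "card {a \<in> {..<r}. cell_step g r q a \<noteq> {} \<and> cell_step g r q a \<notin> cell r ` {..<r}} \<le> \<theta>"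
      if q: "q \<in> cell_states" for q
    proof (cases "q = {}")
      case True
      then show ?thesis by (simp add: cell_step_def)
    next
      case False
      then obtain c d where "c \<le> d" "g ` q = {c..d}"
        using image_cell_state[OF cont self q] by auto
      then show ?thesis
        using card_nonbase_cell_step[OF \<open>0 < r\<close>, of c d] \<open>4 \<le> \<theta>\<close> unfolding cell_step_def by simp
    qed
    show "0 < \<theta>" using \<open>4 \<le> \<theta>\<close> by simp
  qed (use loops cell_step_closed[OF cont self] in \<open>auto simp: cell_step_def\<close>)
  obtain C k where "\<forall>q\<in>cell_states. \<forall>n. card {ws. (set ws \<subseteq> {..<r} \<and> length ws = n) \<and>
      foldl (cell_step g r) q ws \<noteq> {}} \<le> C * (n + 1) ^ k * \<theta> ^ n"
    using card_live_words_le by blast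
  then show ?thesis using cell_in_cell_states by blast
qed

text \<open>A point is coded by its own cell and the cells visited at times \<open>1\<close> to
  \<open>m\<close> under \<open>f ^^ N\<close>. Points with equal codes are within
  \<open>1 / r\<close> at multiples of \<open>N\<close>, hence within \<open>\<epsilon>\<close> at
  the times between, so the code is injective on \<open>E\<close>. Code words are live because an
  orbit follows them.\<close>

lemma separated_card_le:
  fixes f :: "real \<Rightarrow> real"
  assumes cont: "continuous_on {0..1} f" and self: "f ` {0..1} \<subseteq> {0..1::real}" and "0 < r" "0 < N"
    and modulus: "\<And>x y l. x \<in> {0..1} \<Longrightarrow> y \<in> {0..1} \<Longrightarrow> dist x y \<le> 1 / real r \<Longrightarrow> l < N \<Longrightarrow>
      dist ((f ^^ l) x) ((f ^^ l) y) \<le> \<epsilon>"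
    and words: "\<And>a. a < r \<Longrightarrow> card {ws. (set ws \<subseteq> {..<r} \<and> length ws = m) \<and>
      foldl (cell_step (f ^^ N) r) (cell r a) ws \<noteq> {}} \<le> b"
    and E: "E \<subseteq> {0..1}" "finite E" "separated f n \<epsilon> E" and n: "n \<le> N * m"
  shows "card E \<le> r * b"
proof -
  define g where "g = f ^^ N"
  have gmem: "(g ^^ i) x \<in> {0..1}" if "x \<in> {0..1}" for i x
    using funpow_image_subset[OF funpow_image_subset[OF self, of N], of i] that unfolding g_def by blast
  define w where "w x = map (\<lambda>i. cell_index r ((g ^^ Suc i) x)) [0..<m]" for x
  define V where "V a = {ws. (set ws \<subseteq> {..<r} \<and> length ws = m) \<and>
      foldl (cell_step g r) (cell r a) ws \<noteq> {}}" for a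
  have finV: "finite (V a)" for a
    unfolding V_def by (rule finite_subset[OF _ finite_lists_length_eq[of "{..<r}" m]]) auto
  have "inj_on (\<lambda>x. (cell_index r x, w x)) E"
  proof (rule inj_onI, rule ccontr)
    fix x y assume xy: "x \<in> E" "y \<in> E" "x \<noteq> y" and eq: "(cell_index r x, w x) = (cell_index r y, w y)"
    have x01: "x \<in> {0..1}" "y \<in> {0..1}" using xy E(1) by auto
    obtain j where j: "j < n" "dist ((f ^^ j) x) ((f ^^ j) y) > \<epsilon>"
      using E(3) xy unfolding separated_def by blast
    define i where "i = j div N"
    have "i < m" using j(1) n unfolding i_def
      by (metis less_le_trans less_mult_imp_div_less mult.commute)
    have "cell_index r ((g ^^ i) x) = cell_index r ((g ^^ i) y)"
    proof (cases i)
      case 0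
      then show ?thesis using eq by simp
    next
      case (Suc k)
      have "w x ! k = w y ! k" using eq by simp
      then show ?thesis using Suc \<open>i < m\<close> by (simp add: w_def)
    qed
    then have "dist ((g ^^ i) x) ((g ^^ i) y) \<le> 1 / real r"
      using dist_cell_le[OF \<open>0 < r\<close>] mem_cell_index[OF \<open>0 < r\<close> gmem[OF x01(1)], of i]
        mem_cell_index[OF \<open>0 < r\<close> gmem[OF x01(2)], of i] by simp
    then have "dist ((f ^^ (j mod N)) ((g ^^ i) x)) ((f ^^ (j mod N)) ((g ^^ i) y)) \<le> \<epsilon>"
      using \<open>0 < N\<close> by (intro modulus gmem x01) auto
    moreover have "(f ^^ (j mod N)) ((g ^^ i) z) = (f ^^ j) z" for z
    proof -
      have "(f ^^ (j mod N)) ((g ^^ i) z) = (f ^^ (j mod N + N * i)) z"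
        unfolding g_def funpow_mult funpow_add by simp
      then show ?thesis by (simp add: i_def)
    qed
    ultimately show False using j(2) by simp
  qed
  moreover have "(\<lambda>x. (cell_index r x, w x)) ` E \<subseteq> (SIGMA a:{..<r}. V a)"
  proof (rule image_subsetI)
    fix x assume "x \<in> E"
    then have x: "x \<in> {0..1}" using E(1) by auto
    have "(g ^^ length (w x)) x \<in> foldl (cell_step g r) (cell r (cell_index r x)) (w x)"
      by (rule funpow_mem_foldl_cell_step[OF mem_cell_index[OF \<open>0 < r\<close> x]])
        (use mem_cell_index[OF \<open>0 < r\<close> gmem[OF x]] in \<open>simp add: w_def del: funpow.simps\<close>)
    then have "w x \<in> V (cell_index r x)"
      using cell_index_less[OF \<open>0 < r\<close>] by (auto simp: V_def w_def)
    then show "(cell_index r x, w x) \<in> (SIGMA a:{..<r}. V a)"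
      using cell_index_less[OF \<open>0 < r\<close>] by auto
  qed
  ultimately have "card E \<le> card (SIGMA a:{..<r}. V a)"
    using finV by (intro card_inj_on_le) auto
  also have "\<dots> = (\<Sum>a<r. card (V a))" using finV by (simp add: card_SigmaI)
  also have "\<dots> \<le> (\<Sum>a<r. b)" using words by (intro sum_mono) (simp add: V_def g_def)
  finally show ?thesis by simp
qed

text \<open>This controls the steps of \<open>f\<close> between consecutive observations under
  \<open>f ^^ N\<close>, which a word of cells does not record.\<close>

lemma funpow_common_modulus:
  fixes f :: "real \<Rightarrow> real"
  assumes cont: "continuous_on {0..1} f" and self: "f ` {0..1} \<subseteq> {0..1::real}" and "0 < \<epsilon>"
  shows "\<exists>r>0. \<forall>l<N. \<forall>x\<in>{0..1}. \<forall>y\<in>{0..1}. dist x y \<le> 1 / real r \<longrightarrow> dist ((f ^^ l) x) ((f ^^ l) y) \<le> \<epsilon>"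
proof -
  have "\<forall>\<^sub>F e in at_right 0. \<forall>x\<in>{0..1}. \<forall>y\<in>{0..1}. dist x y \<le> e \<longrightarrow> dist ((f ^^ l) x) ((f ^^ l) y) \<le> \<epsilon>" for l
  proof -
    have "uniformly_continuous_on {0..1} (f ^^ l)"
      by (rule compact_uniformly_continuous[OF continuous_on_funpow[OF cont self] compact_Icc])
    then obtain d where "d > 0" "\<forall>x\<in>{0..1}. \<forall>y\<in>{0..1}. dist y x < d \<longrightarrow> dist ((f ^^ l) y) ((f ^^ l) x) < \<epsilon>"
      using \<open>0 < \<epsilon>\<close> unfolding uniformly_continuous_on_def by meson
    then show ?thesis unfolding eventually_at_right_field
      by (intro exI[of _ d]) (meson less_imp_le order_le_less_trans)
  qed
  then have "\<forall>\<^sub>F e in at_right 0. \<forall>l\<in>{..<N}. \<forall>x\<in>{0..1}. \<forall>y\<in>{0..1}. dist x y \<le> e \<longrightarrow>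
      dist ((f ^^ l) x) ((f ^^ l) y) \<le> \<epsilon>"
    by (intro eventually_ball_finite[OF finite_lessThan] ballI) auto
  then obtain b :: real where b: "b > 0" "\<And>e. 0 < e \<Longrightarrow> e < b \<Longrightarrow> \<forall>l\<in>{..<N}. \<forall>x\<in>{0..1}. \<forall>y\<in>{0..1}.
      dist x y \<le> e \<longrightarrow> dist ((f ^^ l) x) ((f ^^ l) y) \<le> \<epsilon>"
    unfolding eventually_at_right_field by blast
  obtain r where r: "inverse (real (Suc r)) < b" using reals_Archimedean[OF b(1)] by auto
  then show ?thesis
    using b(2)[of "1 / real (Suc r)"] by (intro exI[of _ "Suc r"]) (simp add: inverse_eq_divide)
qed

section \<open>Existence of horseshoes\<close>

lemma horseshoe_subset: "horseshoe g J K \<Longrightarrow> J' \<subseteq> J \<Longrightarrow> horseshoe g J' K"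
  unfolding horseshoe_def by (meson finite_subset subsetD)

text \<open>Distinct cells whose indices have the same parity are disjoint. Keeping only the return
  words with the most frequent pattern of parities costs a factor \<open>2 ^ t\<close>, and makes the
  intervals pairwise disjoint.\<close>

lemma return_words_horseshoe:
  fixes g :: "real \<Rightarrow> real"
  assumes cont: "continuous_on {0..1} g" and self: "g ` {0..1} \<subseteq> {0..1}" and "a < r"
    and many: "2 ^ t * b <
      card {ws. set ws \<subseteq> {..<r} \<and> length ws = t \<and> foldl (cell_step g r) (cell r a) ws = cell r a}"
  shows "\<exists>(J :: nat list set) K. horseshoe (g ^^ t) J K \<and> b < card J"
proof -
  define L where "L = {ws. set ws \<subseteq> {..<r} \<and> length ws = t \<and> foldl (cell_step g r) (cell r a) ws = cell r a}"
  have "0 < r" using \<open>a < r\<close> by simp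
  have "finite L"
    unfolding L_def by (rule finite_subset[OF _ finite_lists_length_eq[of "{..<r}" t]]) auto
  define par where "par = map (\<lambda>i::nat. i mod 2)"
  define Y where "Y = {ys. set ys \<subseteq> {0, 1::nat} \<and> length ys = t}"
  have Y: "finite Y" "card Y = 2 ^ t"
    unfolding Y_def using finite_lists_length_eq[of "{0, 1::nat}" t] card_lists_length_eq[of "{0, 1::nat}" t]
    by (simp_all add: numeral_2_eq_2)
  have "par \<in> L \<rightarrow> Y" unfolding par_def L_def Y_def by (auto simp: not_mod_2_eq_0_eq_1)
  moreover have "Y \<noteq> {}" using Y(2) by auto
  ultimately obtain y where y: "card L \<le> card (par -` {y} \<inter> L) * card Y"
    using pigeonhole_card[of par L Y] \<open>finite L\<close> Y(1) by blast
  define J where "J = par -` {y} \<inter> L"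
  have "2 ^ t * b < 2 ^ t * card J"
    using less_le_trans[OF many[folded L_def] y[folded J_def]] by (simp only: Y(2) mult.commute)
  then have "b < card J" by simp
  have "\<exists>u v. u \<le> v \<and> {u..v} \<subseteq> cell r a \<and> (\<forall>i<t. (g ^^ Suc i) ` {u..v} \<subseteq> cell r (ws ! i)) \<and>
      (g ^^ t) ` {u..v} = cell r a" if "ws \<in> L" for ws
  proof -
    have ws: "length ws = t" "foldl (cell_step g r) (cell r a) ws = cell r a" using that by (auto simp: L_def)
    \<comment> \<open>The states along the word form a covering chain from the cell back to itself,
      so some subinterval is mapped onto the whole cell while following \<open>ws\<close>.\<close>
    define I where "I i = foldl (cell_step g r) (cell r a) (take i ws)" for i
    have step: "I (Suc i) = g ` I i \<inter> cell r (ws ! i)" if "i < t" for i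
      using that ws(1) by (simp add: I_def take_Suc_conv_app_nth cell_step_def)
    have It: "I t = cell r a" using ws by (simp add: I_def)
    have st: "I i \<in> cell_states" for i
      unfolding I_def by (rule foldl_cell_step_closed[OF cont self cell_in_cell_states[OF \<open>a < r\<close>]])
    have ne: "I i \<noteq> {}" if "i \<le> t" for i
    proof
      assume "I i = {}"
      then have "foldl (cell_step g r) (I i) (drop i ws) = {}" by simp
      then have "cell r a = {}" using ws unfolding I_def by (simp flip: foldl_append)
      then show False by (auto simp: cell_def divide_right_mono)
    qed
    have "\<exists>u v. u \<le> v \<and> (\<forall>i\<le>t. (g ^^ i) ` {u..v} \<subseteq> I i) \<and> (g ^^ t) ` {u..v} = I t"
    proof (rule covering_chain[OF cont])
      show "\<exists>c d. c \<le> d \<and> I i = {c..d}" if "i \<le> t" for i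
        using st[of i] ne[OF that] by (auto simp: cell_states_def)
      show "I i \<subseteq> {0..1}" if "i < t" for i
        using st[of i] by (auto simp: cell_states_def)
      show "I (Suc i) \<subseteq> g ` I i" if "i < t" for i
        using step[OF that] by blast
    qed
    then obtain u v where uv: "u \<le> v" "\<And>i. i \<le> t \<Longrightarrow> (g ^^ i) ` {u..v} \<subseteq> I i"
      "(g ^^ t) ` {u..v} = I t" by blast
    have "{u..v} \<subseteq> cell r a" using uv(2)[of 0] by (simp add: I_def)
    moreover have "(g ^^ Suc i) ` {u..v} \<subseteq> cell r (ws ! i)" if "i < t" for i
      using uv(2)[of "Suc i"] step[OF that] that by (simp del: funpow.simps)
    ultimately show ?thesis using uv It by metis
  qed
  then obtain u v where uv: "\<And>ws. ws \<in> L \<Longrightarrow> u ws \<le> v ws \<and> {u ws..v ws} \<subseteq> cell r a \<and>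
      (\<forall>i<t. (g ^^ Suc i) ` {u ws..v ws} \<subseteq> cell r (ws ! i)) \<and> (g ^^ t) ` {u ws..v ws} = cell r a"
    by metis
  have "{u ws..v ws} \<inter> {u ws'..v ws'} = {}" if ws: "ws \<in> J" "ws' \<in> J" "ws \<noteq> ws'" for ws ws'
  proof (rule ccontr)
    have len: "length ws = t" "length ws' = t" and L: "ws \<in> L" "ws' \<in> L" and par: "par ws = par ws'"
      using ws by (auto simp: J_def L_def)
    obtain i where i: "i < t" "ws ! i \<noteq> ws' ! i" using ws(3) len by (auto simp: list_eq_iff_nth_eq)
    assume "{u ws..v ws} \<inter> {u ws'..v ws'} \<noteq> {}"
    then obtain x where x: "x \<in> {u ws..v ws}" "x \<in> {u ws'..v ws'}" by blast
    then have "(g ^^ Suc i) x \<in> cell r (ws ! i) \<inter> cell r (ws' ! i)"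
      using uv[OF L(1)] uv[OF L(2)] i(1) by blast
    moreover have "(ws ! i) mod 2 = (ws' ! i) mod 2"
      using arg_cong[OF par, of "\<lambda>l. l ! i"] i(1) len by (simp add: par_def)
    ultimately show False using cell_disjoint[OF \<open>0 < r\<close> _ i(2)] by simp
  qed
  moreover have "finite J" using \<open>finite L\<close> by (simp add: J_def)
  moreover have "J \<subseteq> L" by (auto simp: J_def)
  \<comment> \<open>Each interval is mapped onto \<open>cell r a\<close>, which contains all of
    them; this gives every required covering.\<close>
  ultimately have "horseshoe (g ^^ t) J (\<lambda>ws. {u ws..v ws})"
    unfolding horseshoe_def using uv cell_subset[OF \<open>a < r\<close>] by (smt (verit) subsetD subset_trans)
  then show ?thesis using \<open>b < card J\<close> by blast
qed

section \<open>From exponential growth of separated sets to a horseshoe\<close>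

lemma power_mult_exp_neg_tendsto_0:
  fixes c :: real
  assumes "0 < c"
  shows "(\<lambda>m. (real m + 1) ^ k * exp (- (c * (real m + 1)))) \<longlonglongrightarrow> 0"
proof -
  have lim: "filterlim (\<lambda>m. c * (real m + 1)) at_top sequentially"
    using filterlim_tendsto_pos_mult_at_top[OF tendsto_const assms
        filterlim_tendsto_add_at_top[OF tendsto_const[of 1] filterlim_real_sequentially]]
    by (simp add: add.commute)
  have "(\<lambda>m. (c * (real m + 1)) ^ k / exp (c * (real m + 1))) \<longlonglongrightarrow> 0"
    by (rule filterlim_compose[OF tendsto_power_div_exp_0 lim])
  then have "(\<lambda>m. inverse (c ^ k) * ((c * (real m + 1)) ^ k / exp (c * (real m + 1)))) \<longlonglongrightarrow> inverse (c ^ k) * 0"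
    by (intro tendsto_mult tendsto_const)
  moreover have "inverse (c ^ k) * ((c * (real m + 1)) ^ k / exp (c * (real m + 1))) =
      (real m + 1) ^ k * exp (- (c * (real m + 1)))" for m
    using assms by (simp add: power_mult_distrib exp_minus divide_inverse)
  ultimately show ?thesis by simp
qed

lemma separated_growth_gt:
  assumes "ereal y < separated_growth f X \<epsilon>"
  shows "\<exists>n>N. \<exists>E. E \<subseteq> X \<and> finite E \<and> E \<noteq> {} \<and> separated f n \<epsilon> E \<and> exp (y * real n) < real (card E)"
proof (rule ccontr)
  assume contra: "\<not> ?thesis"
  have "separated_growth f X \<epsilon> \<le> ereal y"
    unfolding separated_growth_def
  proof (rule Limsup_bounded)
    show "\<forall>\<^sub>F n in sequentially. (SUP E\<in>{E. E \<subseteq> X \<and> finite E \<and> E \<noteq> {} \<and> separated f n \<epsilon> E}.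
          ereal (ln (real (card E)) / real n)) \<le> ereal y"
      using eventually_gt_at_top[of N]
    proof eventually_elim
      case (elim n)
      show ?case
      proof (rule SUP_least)
        fix E assume E: "E \<in> {E. E \<subseteq> X \<and> finite E \<and> E \<noteq> {} \<and> separated f n \<epsilon> E}"
        then have "\<not> exp (y * real n) < real (card E)" using contra elim by blast
        moreover have "0 < card E" using E by (simp add: card_gt_0_iff)
        ultimately have "real (card E) \<le> exp (y * real n)" "0 < card E" by simp_all
        then have "ln (real (card E)) \<le> y * real n"
          by (metis ln_exp ln_le_cancel_iff exp_gt_zero of_nat_0_less_iff)
        then show "ereal (ln (real (card E)) / real n) \<le> ereal y"
          using elim by (simp add: divide_le_eq)
      qed
    qed
  qed
  then show False using assms by simp
qed

text \<open>If every cell had at most \<open>\<theta> ^ t\<close> return words of each length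
  \<open>t\<close>, then live words, and with them separated sets, would grow at a rate of at most
  \<open>ln \<theta>\<close> per \<open>N\<close> steps, which is less than
  \<open>\<mu> * N\<close>.\<close>

lemma exists_many_return_words:
  fixes f :: "real \<Rightarrow> real"
  assumes cont: "continuous_on {0..1} f" and self: "f ` {0..1} \<subseteq> {0..1}"
    and h: "ereal \<mu> < topological_entropy f {0..1}" and "0 < \<mu>" and "0 < N" and "4 \<le> \<theta>"
    and \<theta>: "real \<theta> < exp (\<mu> * real N)"
  shows "\<exists>r a t. a < r \<and> \<theta> ^ t < card {ws. set ws \<subseteq> {..<r} \<and> length ws = t \<and>
    foldl (cell_step (f ^^ N) r) (cell r a) ws = cell r a}"
proof (rule ccontr)
  assume contra: "\<not> ?thesis"
  define g where "g = f ^^ N"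
  have g: "continuous_on {0..1} g" "g ` {0..1} \<subseteq> {0..1}"
    unfolding g_def using continuous_on_funpow[OF cont self] funpow_image_subset[OF self] by auto
  obtain \<epsilon> where \<epsilon>: "\<epsilon> > 0" "ereal \<mu> < separated_growth f {0..1} \<epsilon>"
    using h unfolding topological_entropy_def by (auto simp: less_SUP_iff)
  obtain r where r: "r > 0" "\<And>l x y. l < N \<Longrightarrow> x \<in> {0..1} \<Longrightarrow> y \<in> {0..1} \<Longrightarrow>
      dist x y \<le> 1 / real r \<Longrightarrow> dist ((f ^^ l) x) ((f ^^ l) y) \<le> \<epsilon>"
    using funpow_common_modulus[OF cont self \<epsilon>(1), of N] by blast
  obtain C k where Ck: "\<And>a n. a < r \<Longrightarrow> card {ws. (set ws \<subseteq> {..<r} \<and> length ws = n) \<and>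
      foldl (cell_step g r) (cell r a) ws \<noteq> {}} \<le> C * (n + 1) ^ k * \<theta> ^ n"
    using card_cell_words_le[OF g r(1) \<open>4 \<le> \<theta>\<close>] contra unfolding g_def by (meson not_less)
  define c where "c = \<mu> * real N - ln (real \<theta>)"
  have "ln (real \<theta>) < \<mu> * real N"
    using \<theta> \<open>4 \<le> \<theta>\<close> by (metis ln_exp ln_less_cancel_iff exp_gt_zero of_nat_0_less_iff zero_less_numeral less_le_trans)
  then have "0 < c" by (simp add: c_def)
  \<comment> \<open>\<open>D\<close> collects the constants: \<open>D * exp (c * (m + 1))\<close> is
    the lower bound \<open>exp (\<mu> * N * (m - 1))\<close> divided by
    \<open>\<theta> ^ m\<close>.\<close>
  define D where "D = exp (- 2 * \<mu> * real N + ln (real \<theta>))"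
  have "(\<lambda>m. real (r * C) * ((real m + 1) ^ k * exp (- (c * (real m + 1))))) \<longlonglongrightarrow> real (r * C) * 0"
    by (intro tendsto_mult tendsto_const power_mult_exp_neg_tendsto_0 \<open>0 < c\<close>)
  then have "\<forall>\<^sub>F m in sequentially. real (r * C) * ((real m + 1) ^ k * exp (- (c * (real m + 1)))) < D"
    by (rule order_tendstoD) (simp add: D_def)
  then obtain m0 where m0: "\<And>m. m \<ge> m0 \<Longrightarrow> real (r * C) * ((real m + 1) ^ k * exp (- (c * (real m + 1)))) < D"
    unfolding eventually_sequentially by blast
  obtain n E where n: "n > N * m0" and E: "E \<subseteq> {0..1}" "finite E" "separated f n \<epsilon> E"
      and card: "exp (\<mu> * real n) < real (card E)"
    using separated_growth_gt[OF \<epsilon>(2), of "N * m0"] by blast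
  \<comment> \<open>Rounding up gives \<open>n \<le> N * m\<close>, as the coding requires, while
    \<open>N * (m - 1) \<le> n\<close> keeps the loss within one block.\<close>
  define m where "m = n div N + 1"
  have "n \<le> N * m" using \<open>0 < N\<close> unfolding m_def
    by (metis dividend_less_times_div add.commute less_imp_le mult_Suc_right plus_1_eq_Suc)
  have "m0 \<le> m" using n \<open>0 < N\<close> unfolding m_def
    by (metis div_le_mono less_imp_le nonzero_mult_div_cancel_left not_gr_zero trans_le_add1)
  have "N * (m - 1) \<le> n" unfolding m_def by simp
  then have "real N * (real m - 1) \<le> real n" 
    by (simp add: m_def flip: of_nat_mult)
  then have "\<mu> * (real N * (real m - 1)) \<le> \<mu> * real n"
    using \<open>0 < \<mu>\<close> by (intro mult_left_mono) auto
  then have "exp (\<mu> * (real N * (real m - 1))) \<le> exp (\<mu> * real n)" by simp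
  also have "\<dots> < real (card E)" by (rule card)
  also have "card E \<le> r * (C * (m + 1) ^ k * \<theta> ^ m)"
    using r Ck unfolding g_def
    by (intro separated_card_le[OF cont self r(1) \<open>0 < N\<close> _ _ E \<open>n \<le> N * m\<close>]) auto
  finally have "exp (\<mu> * (real N * (real m - 1))) < real (r * (C * (m + 1) ^ k * \<theta> ^ m))" by simp
  also have "\<dots> = real (r * C) * (real m + 1) ^ k * exp (real m * ln (real \<theta>))"
    using \<open>4 \<le> \<theta>\<close> by (simp add: exp_of_nat_mult add.commute)
  finally have "exp (\<mu> * (real N * (real m - 1))) * exp (- (real m * ln (real \<theta>))) <
      real (r * C) * (real m + 1) ^ k * exp (real m * ln (real \<theta>)) * exp (- (real m * ln (real \<theta>)))"
    by (intro mult_strict_right_mono) auto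
  also have "\<dots> = real (r * C) * (real m + 1) ^ k" by (simp add: mult.assoc flip: exp_add)
  also have "exp (\<mu> * (real N * (real m - 1))) * exp (- (real m * ln (real \<theta>))) = D * exp (c * (real m + 1))"
    unfolding D_def c_def by (simp add: algebra_simps flip: exp_add)
  finally have "D * exp (c * (real m + 1)) * exp (- (c * (real m + 1))) <
      real (r * C) * (real m + 1) ^ k * exp (- (c * (real m + 1)))"
    by (intro mult_strict_right_mono) auto
  then have "D < real (r * C) * (real m + 1) ^ k * exp (- (c * (real m + 1)))"
    by (simp add: mult.assoc flip: exp_add)
  then show False using m0[OF \<open>m0 \<le> m\<close>] by (simp add: mult.assoc)
qed

text \<open>Return words are produced at the rate \<open>2 * (s0 + 1)\<close>: the factor 2 pays for
  the choice of a parity pattern, and the summand 1 leaves more than \<open>s0 ^ t\<close>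
  intervals, so that a marker can be spared.\<close>

lemma exists_horseshoe:
  fixes f :: "real \<Rightarrow> real"
  assumes cont: "continuous_on {0..1} f" and self: "f ` {0..1} \<subseteq> {0..1}"
    and h: "ereal \<kappa> < topological_entropy f {0..1}" and "0 \<le> \<kappa>"
  shows "\<exists>M s (J :: nat list set) K. 0 < M \<and> 0 < s \<and> horseshoe (f ^^ M) J K \<and> card J = Suc s \<and>
    \<kappa> \<le> ln (real s) / real M"
proof -
  obtain \<mu> where "ereal \<kappa> < ereal \<mu>" and \<mu>: "ereal \<mu> < topological_entropy f {0..1}"
    using ereal_dense2[OF h] by blast
  then have "\<kappa> < \<mu>" by simp
  then have "0 < \<mu>" using \<open>0 \<le> \<kappa>\<close> by simp
  \<comment> \<open>The number 6 arises because \<open>s0\<close> exceeds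
    \<open>exp (\<kappa> * N)\<close> by at most 1 and this exponential is at least 1, whence
    \<open>2 * (s0 + 1) \<le> 6 * exp (\<kappa> * N)\<close>.\<close>
  obtain N0 where "ln 6 < real N0 * (\<mu> - \<kappa>)" using reals_Archimedean3[of "\<mu> - \<kappa>"] \<open>\<kappa> < \<mu>\<close> by auto
  define N where "N = Suc N0"
  have N: "0 < N" "ln 6 < (\<mu> - \<kappa>) * real N"
    using \<open>ln 6 < real N0 * (\<mu> - \<kappa>)\<close> \<open>\<kappa> < \<mu>\<close> by (auto simp: N_def algebra_simps)
  define s0 where "s0 = nat \<lceil>exp (\<kappa> * real N)\<rceil>"
  have e1: "1 \<le> exp (\<kappa> * real N)" using \<open>0 \<le> \<kappa>\<close> by simp
  then have s0: "exp (\<kappa> * real N) \<le> real s0" "real s0 \<le> exp (\<kappa> * real N) + 1" "1 \<le> s0"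
    unfolding s0_def by linarith+
  have "real (2 * (s0 + 1)) \<le> 6 * exp (\<kappa> * real N)"
  proof -
    have "2 * (x + 1) \<le> 6 * e" if "x \<le> e + 1" "1 \<le> e" for x e :: real
      using that by argo
    from this[OF s0(2) e1] show ?thesis by simp
  qed
  also have "\<dots> = exp (ln 6 + \<kappa> * real N)" by (simp add: exp_add)
  also have "\<dots> < exp (\<mu> * real N)" using N(2) by (simp add: algebra_simps)
  finally have \<theta>: "real (2 * (s0 + 1)) < exp (\<mu> * real N)" .
  obtain r a t where rat: "a < r" and big: "(2 * (s0 + 1)) ^ t < card {ws. set ws \<subseteq> {..<r} \<and> length ws = t \<and>
      foldl (cell_step (f ^^ N) r) (cell r a) ws = cell r a}"
    using exists_many_return_words[OF cont self \<mu> \<open>0 < \<mu>\<close> N(1) _ \<theta>] s0(3) by auto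
  have "0 < t"
  proof (rule ccontr)
    assume "\<not> 0 < t"
    then have "{ws. set ws \<subseteq> {..<r} \<and> length ws = t \<and>
      foldl (cell_step (f ^^ N) r) (cell r a) ws = cell r a} \<subseteq> {[]}" by auto
    from card_mono[OF _ this] big \<open>\<not> 0 < t\<close> show False by simp
  qed
  have "2 ^ t * (s0 + 1) ^ t < card {ws. set ws \<subseteq> {..<r} \<and> length ws = t \<and>
      foldl (cell_step (f ^^ N) r) (cell r a) ws = cell r a}"
    using big by (simp only: power_mult_distrib)
  from return_words_horseshoe[OF continuous_on_funpow[OF cont self] funpow_image_subset[OF self] rat this]
  obtain J :: "nat list set" and K where JK: "horseshoe ((f ^^ N) ^^ t) J K" "(s0 + 1) ^ t < card J"
    by blast
  have "s0 ^ t < (s0 + 1) ^ t" using \<open>0 < t\<close> by (intro power_strict_mono) auto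
  then have "Suc (s0 ^ t) \<le> card J" using JK(2) by simp
  then obtain J' where J': "J' \<subseteq> J" "card J' = Suc (s0 ^ t)" by (meson obtain_subset_with_card_n)
  have "horseshoe (f ^^ (N * t)) J' K"
    using horseshoe_subset[OF JK(1) J'(1)] by (simp add: funpow_mult)
  moreover have "\<kappa> \<le> ln (real (s0 ^ t)) / real (N * t)"
  proof -
    have "\<kappa> * real N \<le> ln (real s0)" using s0 by (subst ln_ge_iff) auto
    then show ?thesis using N(1) \<open>0 < t\<close> s0(3) by (simp add: ln_realpow field_simps)
  qed
  ultimately show ?thesis
    using J'(2) N(1) \<open>0 < t\<close> s0(3) by (intro exI[of _ "N * t"] exI[of _ "s0 ^ t"] exI[of _ J'] exI[of _ K]) auto
qed

section \<open>Monotonicity and a Lipschitz bound\<close>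

lemma separated_growth_mono:
  assumes "X \<subseteq> Y"
  shows "separated_growth f X \<epsilon> \<le> separated_growth f Y \<epsilon>"
  unfolding separated_growth_def
  using assms by (intro Limsup_mono always_eventually allI SUP_subset_mono order_refl) auto

lemma topological_entropy_nonneg: "0 \<le> topological_entropy f X"
proof (cases "X = {}")
  case False
  then obtain x where "x \<in> X" by blast
  have "ereal 0 \<le> separated_growth f X 1"
    by (rule separated_growth_ge) (use \<open>x \<in> X\<close> in \<open>auto intro!: exI[of _ "{x}"] simp: separated_def\<close>)
  also have "\<dots> \<le> topological_entropy f X"
    using False by (intro separated_growth_le_topological_entropy) auto
  finally show ?thesis by (simp add: zero_ereal_def)
qed (simp add: topological_entropy_def)

lemma topological_entropy_mono:
  assumes "X \<subseteq> Y"
  shows "topological_entropy f X \<le> topological_entropy f Y"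
proof (cases "X = {}")
  case True
  then have "topological_entropy f X = 0" by (simp add: topological_entropy_def)
  then show ?thesis by (simp add: topological_entropy_nonneg)
next
  case False
  then show ?thesis using assms unfolding topological_entropy_def
    by (auto intro!: SUP_mono' separated_growth_mono)
qed

text \<open>Points closer than \<open>\<epsilon> / L ^ n\<close> cannot be separated within
  \<open>n\<close> steps, since \<open>1 \<le> L\<close> makes \<open>L ^ n\<close> dominate the
  earlier powers. So each piece of a grid of that mesh holds at most one point of
  \<open>E\<close>.\<close>

lemma separated_card_le_lipschitz:
  fixes f :: "real \<Rightarrow> real"
  assumes inv: "f ` X \<subseteq> X" and X: "X \<subseteq> {0..1}" and "1 \<le> L" and "0 < \<epsilon>"
    and lip: "\<And>x y. x \<in> X \<Longrightarrow> y \<in> X \<Longrightarrow> dist (f x) (f y) \<le> L * dist x y"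
    and E: "E \<subseteq> X" "finite E" "separated f n \<epsilon> E"
  shows "real (card E) \<le> L ^ n * (1 / \<epsilon> + 1)"
proof -
  have lip_funpow: "dist ((f ^^ i) x) ((f ^^ i) y) \<le> L ^ i * dist x y" if "x \<in> X" "y \<in> X" for i x y
  proof (induction i)
    case (Suc i)
    have "dist (f ((f ^^ i) x)) (f ((f ^^ i) y)) \<le> L * dist ((f ^^ i) x) ((f ^^ i) y)"
      using funpow_image_subset[OF inv, of i] that by (intro lip) auto
    also have "\<dots> \<le> L * (L ^ i * dist x y)" using Suc \<open>1 \<le> L\<close> by (intro mult_left_mono) auto
    finally show ?case by (simp add: mult.assoc)
  qed simp
  define c where "c = L ^ n / \<epsilon>"
  have "0 < c" using assms(3,4) by (simp add: c_def)
  have "inj_on (\<lambda>x. nat \<lfloor>c * x\<rfloor>) E"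
  proof (rule inj_onI, rule ccontr)
    fix x y assume xy: "x \<in> E" "y \<in> E" "nat \<lfloor>c * x\<rfloor> = nat \<lfloor>c * y\<rfloor>" "x \<noteq> y"
    have "x \<in> X" "y \<in> X" "0 \<le> c * x" "0 \<le> c * y" using xy E(1) X \<open>0 < c\<close> by auto
    then have "\<lfloor>c * x\<rfloor> = \<lfloor>c * y\<rfloor>" using xy(3) by (simp add: eq_nat_nat_iff)
    then have "\<bar>c * x - c * y\<bar> < 1" by linarith
    then have "c * dist x y < 1" using \<open>0 < c\<close> by (simp add: dist_real_def abs_mult flip: right_diff_distrib)
    then have small: "L ^ n * dist x y < \<epsilon>" using \<open>0 < \<epsilon>\<close> by (simp add: c_def field_simps)
    obtain i where i: "i < n" "\<epsilon> < dist ((f ^^ i) x) ((f ^^ i) y)"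
      using E(3) xy unfolding separated_def by blast
    note i(2)
    also have "dist ((f ^^ i) x) ((f ^^ i) y) \<le> L ^ i * dist x y" by (rule lip_funpow) fact+
    also have "\<dots> \<le> L ^ n * dist x y"
      using i(1) \<open>1 \<le> L\<close> by (intro mult_right_mono power_increasing) auto
    finally show False using small by simp
  qed
  moreover have "(\<lambda>x. nat \<lfloor>c * x\<rfloor>) ` E \<subseteq> {..nat \<lfloor>c\<rfloor>}"
  proof (rule image_subsetI)
    fix x assume "x \<in> E"
    then have "c * x \<le> c" using E(1) X \<open>0 < c\<close> by (auto intro: mult_left_le)
    then show "nat \<lfloor>c * x\<rfloor> \<in> {..nat \<lfloor>c\<rfloor>}" by (auto intro!: nat_mono floor_mono)
  qed
  ultimately have "card E \<le> card {..nat \<lfloor>c\<rfloor>}" by (intro card_inj_on_le) auto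
  then have "real (card E) \<le> c + 1" using \<open>0 < c\<close> by simp linarith
  also have "\<dots> \<le> L ^ n * (1 / \<epsilon> + 1)"
    using one_le_power[OF \<open>1 \<le> L\<close>, of n] by (simp add: c_def algebra_simps)
  finally show ?thesis .
qed

text \<open>The Lipschitz bound is required on \<open>X\<close> only, which allows the oscillating
  part of the tower to be ignored.\<close>

lemma entropy_le_lipschitz:
  fixes f :: "real \<Rightarrow> real"
  assumes inv: "f ` X \<subseteq> X" and X: "X \<subseteq> {0..1}" and "1 \<le> L"
    and lip: "\<And>x y. x \<in> X \<Longrightarrow> y \<in> X \<Longrightarrow> dist (f x) (f y) \<le> L * dist x y"
  shows "topological_entropy f X \<le> ereal (ln L)"
proof -
  have "separated_growth f X \<epsilon> \<le> ereal (ln L)" if "\<epsilon> > 0" for \<epsilon>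
  proof (rule ccontr)
    assume "\<not> separated_growth f X \<epsilon> \<le> ereal (ln L)"
    then obtain y where "ereal (ln L) < ereal y" and y: "ereal y < separated_growth f X \<epsilon>"
      using ereal_dense2 not_le by meson
    then have pos: "0 < y - ln L" by simp
    then obtain N where N: "ln (1 / \<epsilon> + 1) < real N * (y - ln L)" using reals_Archimedean3 by blast
    obtain n E where n: "n > N" and E: "E \<subseteq> X" "finite E" "separated f n \<epsilon> E"
      and card: "exp (y * real n) < real (card E)"
      using separated_growth_gt[OF y, of N] by blast
    note card
    also have "real (card E) \<le> L ^ n * (1 / \<epsilon> + 1)"
      by (rule separated_card_le_lipschitz[OF inv X \<open>1 \<le> L\<close> that lip E])
    also have "\<dots> = exp (real n * ln L + ln (1 / \<epsilon> + 1))"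
      using \<open>1 \<le> L\<close> that by (simp add: exp_add exp_of_nat_mult add_pos_pos)
    finally have "real n * (y - ln L) < ln (1 / \<epsilon> + 1)" by (simp add: algebra_simps)
    moreover have "real N * (y - ln L) \<le> real n * (y - ln L)" using n pos by (intro mult_right_mono) auto
    ultimately show False using N by simp
  qed
  then show ?thesis using \<open>1 \<le> L\<close>
    unfolding topological_entropy_def by (auto intro!: SUP_least)
qed

section \<open>A tower of intervals with large entropy\<close>

text \<open>On \<open>[0, 2k - 1]\<close> this shifts by 2 up to \<open>2k - 3\<close>, falls from
  \<open>2k - 1\<close> to 0 on the next unit interval, and translates the last unit interval back
  to \<open>[0, 1]\<close>. The form with \<open>max\<close> and \<open>min\<close> gives continuity
  and the Lipschitz bound directly.\<close>

definition skeleton :: "nat \<Rightarrow> real \<Rightarrow> real" where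
  "skeleton k y = max (min (y + 2) ((2 * real k - 1) * (2 * real k - 2 - y))) (y - (2 * real k - 2))"

text \<open>A cosine with \<open>2 * m + 1\<close> monotone laps, each mapping onto
  \<open>[0, 1]\<close>. The number of laps is odd so that 0 and 1 are fixed.\<close>

definition wave :: "nat \<Rightarrow> real \<Rightarrow> real" where
  "wave m y = (1 - cos (pi * (2 * real m + 1) * y)) / 2"

text \<open>On \<open>[0, 1]\<close> the clamped terms put the wave in place of the identity; above
  1 they cancel because \<open>wave m 1 = 1\<close>.\<close>

definition tower :: "nat \<Rightarrow> nat \<Rightarrow> real \<Rightarrow> real" where
  "tower k m y = skeleton k y - max 0 (min 1 y) + wave m (max 0 (min 1 y))"

definition tower_map :: "nat \<Rightarrow> nat \<Rightarrow> real \<Rightarrow> real" where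
  "tower_map k m x = tower k m ((2 * real k - 1) * x) / (2 * real k - 1)"

section \<open>Values and orbits of the tower before rescaling\<close>

lemma wave_even [simp]: "wave m (2 * real i / (2 * real m + 1)) = 0"
proof -
  have "pi * (2 * real m + 1) * (2 * real i / (2 * real m + 1)) = real (2 * i) * pi"
    by (simp add: field_simps add_nonneg_eq_0_iff)
  then show ?thesis unfolding wave_def by (simp only: cos_npi) simp
qed

lemma wave_odd [simp]: "wave m ((2 * real i + 1) / (2 * real m + 1)) = 1"
proof -
  have "pi * (2 * real m + 1) * ((2 * real i + 1) / (2 * real m + 1)) = real (Suc (2 * i)) * pi"
    by (simp add: field_simps add_nonneg_eq_0_iff)
  then show ?thesis unfolding wave_def by (simp only: cos_npi) simp
qed

lemma wave_0 [simp]: "wave m 0 = 0"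
  using wave_even[of m 0] by simp

lemma wave_1 [simp]: "wave m 1 = 1"
  using wave_odd[of m m] by (simp add: add_nonneg_eq_0_iff)

lemma wave_bounds: "0 \<le> wave m y" "wave m y \<le> 1"
  unfolding wave_def using cos_ge_minus_one[of "pi * (2 * real m + 1) * y"] by simp_all

lemma skeleton_left:
  assumes "2 \<le> k" "y \<le> 2 * real k - 3"
  shows "skeleton k y = y + 2"
proof -
  define q where "q = (2 * real k - 1) * (2 * real k - 2 - y)"
  have "2 * real k - 1 \<le> q"
    using mult_left_mono[of 1 "2 * real k - 2 - y" "2 * real k - 1"] assms by (simp add: q_def)
  then show ?thesis using assms unfolding skeleton_def q_def[symmetric] by simp
qed

lemma skeleton_right:
  assumes "2 \<le> k" "2 * real k - 2 \<le> y"
  shows "skeleton k y = y - (2 * real k - 2)"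
proof -
  have "(2 * real k - 1) * (2 * real k - 2 - y) \<le> 0"
    using assms by (intro mult_nonneg_nonpos) auto
  then show ?thesis using assms by (simp add: skeleton_def)
qed

lemma skeleton_bounds:
  assumes "2 \<le> k" "0 \<le> y" "y \<le> 2 * real k - 1"
  shows "0 \<le> skeleton k y" "skeleton k y \<le> 2 * real k - 1"
proof -
  consider "y \<le> 2 * real k - 3" | "2 * real k - 2 \<le> y" | "2 * real k - 3 \<le> y" "y \<le> 2 * real k - 2" by linarith
  then have "0 \<le> skeleton k y \<and> skeleton k y \<le> 2 * real k - 1"
  proof cases
    case 3
    define q where "q = (2 * real k - 1) * (2 * real k - 2 - y)"
    have "0 \<le> q" unfolding q_def using 3 assms by (intro mult_nonneg_nonneg) auto
    moreover have "q \<le> 2 * real k - 1"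
      using mult_left_mono[of "2 * real k - 2 - y" 1 "2 * real k - 1"] 3 assms by (simp add: q_def)
    ultimately show ?thesis using 3 assms unfolding skeleton_def q_def[symmetric]
      by (auto simp: min_def max_def)
  qed (use assms in \<open>simp_all add: skeleton_left skeleton_right\<close>)
  then show "0 \<le> skeleton k y" "skeleton k y \<le> 2 * real k - 1" by auto
qed

lemma abs_max_min_diff_le:
  fixes a b c a' b' c' e :: real
  assumes "\<bar>a - a'\<bar> \<le> e" "\<bar>b - b'\<bar> \<le> e" "\<bar>c - c'\<bar> \<le> e"
  shows "\<bar>max (min a b) c - max (min a' b') c'\<bar> \<le> e"
  using assms by (auto simp: max_def min_def abs_le_iff)

lemma skeleton_lipschitz:
  assumes "2 \<le> k"
  shows "\<bar>skeleton k x - skeleton k y\<bar> \<le> (2 * real k - 1) * \<bar>x - y\<bar>"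
proof -
  have N: "3 \<le> 2 * real k - 1" using assms by simp
  have le: "\<bar>x - y\<bar> \<le> (2 * real k - 1) * \<bar>x - y\<bar>" 
    using mult_right_mono[of 1 "2 * real k - 1" "\<bar>x - y\<bar>"] N by simp
  have "(2 * real k - 1) * (2 * real k - 2 - x) - (2 * real k - 1) * (2 * real k - 2 - y) =
      (2 * real k - 1) * (y - x)" by (simp add: algebra_simps)
  then have "\<bar>(2 * real k - 1) * (2 * real k - 2 - x) - (2 * real k - 1) * (2 * real k - 2 - y)\<bar> =
      (2 * real k - 1) * \<bar>x - y\<bar>" using N by (simp add: abs_mult abs_minus_commute)
  then show ?thesis unfolding skeleton_def by (intro abs_max_min_diff_le) (use le in auto)
qed

lemma tower_base:
  assumes "2 \<le> k" "0 \<le> y" "y \<le> 1"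
  shows "tower k m y = 2 + wave m y"
  using assms skeleton_left[of k y] by (simp add: tower_def min_def max_def)

lemma tower_above: "1 \<le> y \<Longrightarrow> tower k m y = skeleton k y"
  by (simp add: tower_def)

lemma tower_bounds:
  assumes "2 \<le> k" "0 \<le> y" "y \<le> 2 * real k - 1"
  shows "0 \<le> tower k m y" "tower k m y \<le> 2 * real k - 1"
proof -
  have "0 \<le> tower k m y \<and> tower k m y \<le> 2 * real k - 1"
  proof (cases "y \<le> 1")
    case True
    then show ?thesis using assms wave_bounds[of m y] tower_base[of k y m] by simp
  next
    case False
    then show ?thesis using assms skeleton_bounds[of k y] tower_above[of y k m] by simp
  qed
  then show "0 \<le> tower k m y" "tower k m y \<le> 2 * real k - 1" by auto
qed

text \<open>The wave acts only in the first step, on leaving \<open>[0, 1]\<close>; after that each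
  step adds 2. Hence the exclusion of \<open>i = 0\<close>.\<close>

lemma tower_funpow_level:
  assumes "2 \<le> k" "0 \<le> y" "y \<le> 1" "0 < i" "i < k"
  shows "(tower k m ^^ i) y = 2 * real i + wave m y"
  using assms(4,5)
proof (induction i)
  case (Suc i)
  show ?case
  proof (cases "i = 0")
    case True
    then show ?thesis using tower_base[OF assms(1-3)] by simp
  next
    case False
    then have IH: "(tower k m ^^ i) y = 2 * real i + wave m y" using Suc by simp
    have "real i + 2 \<le> real k" using Suc.prems by simp
    then have "tower k m (2 * real i + wave m y) = 2 * real i + wave m y + 2"
      using False wave_bounds[of m y] assms(1) by (subst tower_above) (auto intro!: skeleton_left)
    then show ?thesis using IH by simp
  qed
qed simp

lemma tower_funpow_return:
  assumes "2 \<le> k" "0 \<le> y" "y \<le> 1"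
  shows "(tower k m ^^ k) y = wave m y"
proof -
  obtain j where j: "k = Suc j" "0 < j" using assms(1) by (cases k) auto
  have "(tower k m ^^ j) y = 2 * real j + wave m y" using j by (intro tower_funpow_level assms) auto
  moreover have "tower k m (2 * real j + wave m y) = wave m y"
    using j wave_bounds[of m y] assms(1) by (subst tower_above) (auto simp: skeleton_right)
  ultimately show ?thesis by (simp add: j(1))
qed

text \<open>After \<open>n div k\<close> returns the orbit is again in \<open>[0, 1]\<close>, and a
  remainder \<open>j > 0\<close> would carry it into \<open>[2j, 2j + 1]\<close>, away from
  \<open>y\<close>.\<close>

lemma tower_period_dvd:
  assumes "2 \<le> k" "0 \<le> y" "y \<le> 1" and per: "(tower k m ^^ n) y = y"
  shows "k dvd n"
proof (rule ccontr)
  assume "\<not> k dvd n"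
  define j where "j = n mod k"
  have j: "0 < j" "j < k" using \<open>\<not> k dvd n\<close> assms(1) by (auto simp: j_def mod_greater_zero_iff_not_dvd)
  have ret: "0 \<le> ((tower k m ^^ k) ^^ q) y \<and> ((tower k m ^^ k) ^^ q) y \<le> 1" for q
    by (induction q) (use assms tower_funpow_return[OF assms(1)] wave_bounds in auto)
  define z where "z = ((tower k m ^^ k) ^^ (n div k)) y"
  have "y = (tower k m ^^ (j + k * (n div k))) y" using per by (simp add: j_def)
  also have "\<dots> = (tower k m ^^ j) z" unfolding funpow_add z_def funpow_mult by simp
  also have "\<dots> = 2 * real j + wave m z"
    using ret[of "n div k"] j unfolding z_def by (intro tower_funpow_level assms) auto
  finally show False using j(1) assms(3) wave_bounds[of m z] by simp
qed

section \<open>The tower rescaled to the unit interval\<close>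

lemma tower_map_funpow:
  assumes "2 \<le> k"
  shows "(2 * real k - 1) * (tower_map k m ^^ i) x = (tower k m ^^ i) ((2 * real k - 1) * x)"
proof (induction i)
  case (Suc i)
  have "2 * real k - 1 \<noteq> 0" using assms by simp
  then show ?case using Suc by (simp add: tower_map_def)
qed simp

lemma tower_map_continuous: "2 \<le> k \<Longrightarrow> continuous_on S (tower_map k m)"
  unfolding tower_map_def tower_def skeleton_def wave_def by (intro continuous_intros) auto

lemma tower_map_image: "2 \<le> k \<Longrightarrow> tower_map k m ` {0..1} \<subseteq> {0..1}"
proof (rule image_subsetI)
  fix x :: real assume k: "2 \<le> k" and "x \<in> {0..1}"
  then have "0 \<le> (2 * real k - 1) * x" "(2 * real k - 1) * x \<le> 2 * real k - 1"
    by (auto intro: mult_left_le)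
  from tower_bounds[OF k this, of m] k show "tower_map k m x \<in> {0..1}"
    by (simp add: tower_map_def)
qed

text \<open>These are the rising laps of the wave, kept disjoint by the falling laps between them.
  The first return maps each of them over \<open>[0, 1 / (2k - 1)]\<close>, which contains them
  all.\<close>

lemma tower_map_horseshoe:
  assumes "2 \<le> k"
  shows "horseshoe (tower_map k m ^^ k) {..m}
    (\<lambda>i. {2 * real i / (2 * real m + 1) / (2 * real k - 1)..(2 * real i + 1) / (2 * real m + 1) / (2 * real k - 1)})"
    (is "horseshoe ?g _ ?K")
proof -
  define N where "N = 2 * real k - 1"
  define S where "S = 2 * real m + 1"
  have pos: "0 < N" "1 \<le> N" "0 < S" using assms by (auto simp: N_def S_def)
  have K: "?K i = {2 * real i / S / N..(2 * real i + 1) / S / N}" for i by (simp add: N_def S_def)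
  have sub: "?K i \<subseteq> {0..1 / N}" if "i \<le> m" for i
  proof -
    have "(2 * real i + 1) / S \<le> 1" using that pos by (simp add: S_def)
    then have "(2 * real i + 1) / S / N \<le> 1 / N" using pos by (intro divide_right_mono) auto
    moreover have "0 \<le> 2 * real i / S / N" using pos by simp
    ultimately show ?thesis unfolding K by auto
  qed
  have cov: "{0..1 / N} \<subseteq> ?g ` ?K i" if "i \<le> m" for i
  proof
    fix z assume z: "z \<in> {0..1 / N}"
    have "\<exists>y\<ge>2 * real i / S. y \<le> (2 * real i + 1) / S \<and> wave m y = N * z"
    proof (rule IVT')
      show "continuous_on {2 * real i / S..(2 * real i + 1) / S} (wave m)"
        unfolding wave_def by (intro continuous_intros) auto
      show "2 * real i / S \<le> (2 * real i + 1) / S" using pos by (intro divide_right_mono) auto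
      show "wave m (2 * real i / S) \<le> N * z" using z pos by (simp add: S_def)
      show "N * z \<le> wave m ((2 * real i + 1) / S)" 
        using z pos unfolding S_def wave_odd by (simp add: field_simps)
    qed
    then obtain y where y: "2 * real i / S \<le> y" "y \<le> (2 * real i + 1) / S" "wave m y = N * z" by blast
    have "y / N \<in> ?K i" 
      unfolding K atLeastAtMost_iff using y pos by (intro conjI divide_right_mono) auto
    moreover have "?g (y / N) = z"
    proof -
      have "y / N \<in> {0..1 / N}" using sub[OF that] \<open>y / N \<in> ?K i\<close> by blast
      then have "0 \<le> y" "y \<le> 1" using pos by (auto simp: field_simps)
      then have "N * ?g (y / N) = N * z"
        using tower_map_funpow[OF assms, where i = k and x = "y / N" and m = m] tower_funpow_return[OF assms, of y m] y(3) pos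
        by (simp add: N_def)
      then show ?thesis using pos by simp
    qed
    ultimately show "z \<in> ?g ` ?K i" by blast
  qed
  have dis: "?K i \<inter> ?K j = {}" if "i < j" for i j
  proof -
    have "2 * real i + 1 < 2 * real j" using that by linarith
    then have "(2 * real i + 1) / S / N < 2 * real j / S / N" using pos by (intro divide_strict_right_mono) auto
    then show ?thesis unfolding K by auto
  qed
  have "?K i \<inter> ?K j = {}" if "i \<noteq> j" for i j
    using dis[of i j] dis[of j i] that by (metis Int_commute linorder_neqE_nat)
  moreover have "{0..1 / N} \<subseteq> {0..1}" using pos by auto
  moreover have "\<exists>u v. u \<le> v \<and> ?K i = {u..v}" for i
  proof -
    have "2 * real i / S / N \<le> (2 * real i + 1) / S / N" using pos by (intro divide_right_mono) auto
    then show ?thesis unfolding K by blast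
  qed
  ultimately show ?thesis
    unfolding horseshoe_def using sub cov by (meson atMost_iff finite_atMost order_trans)
qed

text \<open>The horseshoe estimate is applied with all positive integers as admissible
  periods.\<close>

lemma tower_map_entropy_ge:
  assumes "2 \<le> k" "0 < m"
  shows "ereal (ln (real m) / real k) \<le> topological_entropy (tower_map k m) {0..1}"
proof -
  have "ereal (ln (real m) / real k) \<le>
      topological_entropy (tower_map k m) (closure (periodic_points (tower_map k m) {0<..}))"
    by (rule entropy_ge_horseshoe[OF tower_map_continuous tower_map_image tower_map_horseshoe])
      (use assms in auto)
  also have "\<dots> \<le> topological_entropy (tower_map k m) {0..1}"
    by (intro topological_entropy_mono closure_minimal periodic_points_subset) auto
  finally show ?thesis .
qed

text \<open>Periodic points in the oscillating interval have periods divisible by \<open>k\<close>,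
  so none of them is counted. On the remaining closed interval the map is the rescaled skeleton,
  whose Lipschitz constant does not depend on \<open>m\<close>.\<close>

lemma tower_map_periodic_entropy_le:
  assumes k: "2 \<le> k" and A: "\<And>n. n \<in> A \<Longrightarrow> \<not> k dvd n"
  shows "topological_entropy (tower_map k m) (closure (periodic_points (tower_map k m) A))
    \<le> ereal (ln (2 * real k - 1))"
proof -
  define N where "N = 2 * real k - 1"
  have N: "1 \<le> N" using k by (simp add: N_def)
  define X where "X = closure (periodic_points (tower_map k m) A)"
  have "periodic_points (tower_map k m) A \<subseteq> {1 / N..1}"
  proof
    fix x assume x: "x \<in> periodic_points (tower_map k m) A"
    then obtain n where n: "n \<in> A" "(tower_map k m ^^ n) x = x" and x01: "x \<in> {0..1}"
      by (auto simp: periodic_points_def minimal_period_def)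
    have "1 < N * x"
    proof (rule ccontr)
      assume "\<not> 1 < N * x"
      moreover have "(tower k m ^^ n) (N * x) = N * x"
        using tower_map_funpow[OF k, where i = n and x = x and m = m] n(2) by (simp add: N_def)
      ultimately have "k dvd n" using x01 N 
        by (intro tower_period_dvd[OF k, where y = "N * x" and m = m and n = n]) auto
      then show False using A n(1) by blast
    qed
    then show "x \<in> {1 / N..1}" using x01 N by (simp add: field_simps)
  qed
  then have X: "X \<subseteq> {1 / N..1}" unfolding X_def by (intro closure_minimal) auto
  have "topological_entropy (tower_map k m) X \<le> ereal (ln N)"
  proof (rule entropy_le_lipschitz[OF _ _ N])
    show "tower_map k m ` X \<subseteq> X"
      unfolding X_def by (rule closure_periodic_points_invariant[OF tower_map_continuous[OF k] tower_map_image[OF k]])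
    have "{1 / N..1} \<subseteq> {0..1}" using N by simp
    with X show "X \<subseteq> {0..1}" by (rule order_trans)
    fix x y assume xy: "x \<in> X" "y \<in> X"
    have eq: "tower_map k m z = skeleton k (N * z) / N" if "z \<in> X" for z
    proof -
      have "1 \<le> N * z" using X that N by (auto simp: field_simps)
      then show ?thesis unfolding tower_map_def N_def[symmetric] by (simp add: tower_above)
    qed
    have "dist (tower_map k m x) (tower_map k m y) = \<bar>skeleton k (N * x) - skeleton k (N * y)\<bar> / N"
      using N by (simp add: eq xy dist_real_def flip: diff_divide_distrib)
    also have "\<dots> \<le> N * \<bar>N * x - N * y\<bar> / N"
      using N skeleton_lipschitz[OF k] by (intro divide_right_mono) (auto simp: N_def)
    also have "\<dots> = N * dist x y" using N by (simp add: dist_real_def abs_mult flip: right_diff_distrib)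
    finally show "dist (tower_map k m x) (tower_map k m y) \<le> N * dist x y" .
  qed
  then show ?thesis by (simp add: X_def N_def)
qed

section \<open>Assembly of the two implications\<close>

lemma entropy_le_periodic_closure:
  fixes f :: "real \<Rightarrow> real"
  assumes cont: "continuous_on {0..1} f" and self: "f ` {0..1} \<subseteq> {0..1}"
    and A: "\<And>k. 0 < k \<Longrightarrow> \<exists>n\<in>A. k dvd n" "0 \<notin> A"
  shows "topological_entropy f {0..1} \<le> topological_entropy f (closure (periodic_points f A))"
proof (rule ccontr)
  assume "\<not> ?thesis"
  then obtain \<kappa> where \<kappa>: "topological_entropy f (closure (periodic_points f A)) < ereal \<kappa>"
    "ereal \<kappa> < topological_entropy f {0..1}"
    using ereal_dense2 not_le by meson
  \<comment> \<open>Entropy is never negative, so a number strictly above one is positive, as the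
    rate in \<open>exists_horseshoe\<close> must not be negative.\<close>
  have "0 < ereal \<kappa>" using topological_entropy_nonneg \<kappa>(1) by (rule order.strict_trans1)
  then have "0 \<le> \<kappa>" by simp
  then obtain M s and J :: "nat list set" and K where hs: "0 < M" "0 < s" "horseshoe (f ^^ M) J K" "card J = Suc s"
    "\<kappa> \<le> ln (real s) / real M"
    using exists_horseshoe[OF cont self \<kappa>(2)] by blast
  have "ereal \<kappa> \<le> ereal (ln (real s) / real M)" using hs(5) by simp
  also have "\<dots> \<le> topological_entropy f (closure (periodic_points f A))"
    by (rule entropy_ge_horseshoe[OF cont self hs(3,1,4,2) A])
  finally show False using \<kappa>(1) by simp
qed

text \<open>\<open>0 \<notin> A\<close> expresses that \<open>A\<close> consists of positive
  integers. Zero is a multiple of every \<open>k\<close> but never a minimal period, so its presence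
  would make the second property trivially true.\<close>

theorem theorem9p1:
  fixes A :: "nat set"
  assumes "0 \<notin> A"
  shows "(\<forall>f::real \<Rightarrow> real. continuous_on {0..1} f \<and> f ` {0..1} \<subseteq> {0..1} \<longrightarrow>
            topological_entropy f {0..1} = topological_entropy f (closure (periodic_points f A)))
         \<longleftrightarrow> (\<forall>k::nat. 0 < k \<longrightarrow> (\<exists>n\<in>A. k dvd n))"
proof (intro iffI allI impI)
  fix k :: nat
  assume entropy: "\<forall>f::real \<Rightarrow> real. continuous_on {0..1} f \<and> f ` {0..1} \<subseteq> {0..1} \<longrightarrow>
            topological_entropy f {0..1} = topological_entropy f (closure (periodic_points f A))"
    and "0 < k"
  show "\<exists>n\<in>A. k dvd n"
  proof (rule ccontr)
    assume no: "\<not> (\<exists>n\<in>A. k dvd n)"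
    \<comment> \<open>Doubling ensures \<open>2 \<le> l\<close>, as the tower requires, even for
      \<open>k = 1\<close>; multiples of \<open>l\<close> are multiples of \<open>k\<close>.\<close>
    define l where "l = 2 * k"
    have l: "2 \<le> l" using \<open>0 < k\<close> by (simp add: l_def)
    have nol: "\<not> l dvd n" if "n \<in> A" for n
      using no that unfolding l_def by (meson dvd_mult_right)
    \<comment> \<open>Just above \<open>(2 * l - 1) ^ l\<close>, so that \<open>ln m / l\<close>
      exceeds the bound \<open>ln (2 * l - 1)\<close> for the periodic part.\<close>
    define m where "m = (2 * l - 1) ^ l + 1"
    have "ereal (ln (real m) / real l) \<le> topological_entropy (tower_map l m) {0..1}"
      by (rule tower_map_entropy_ge[OF l]) (simp add: m_def)
    also have "\<dots> = topological_entropy (tower_map l m) (closure (periodic_points (tower_map l m) A))"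
      using entropy tower_map_continuous[OF l] tower_map_image[OF l] by blast
    also have "\<dots> \<le> ereal (ln (2 * real l - 1))"
      by (rule tower_map_periodic_entropy_le[OF l nol])
    finally have "ln (real m) \<le> real l * ln (2 * real l - 1)"
      using l by (simp add: divide_le_eq mult.commute)
    also have "\<dots> = ln ((2 * real l - 1) ^ l)" using l by (simp add: ln_realpow)
    also have "\<dots> < ln (real m)"
    proof -
      have "0 < (2 * real l - 1) ^ l" using l by simp
      moreover have "real m = (2 * real l - 1) ^ l + 1" using l by (simp add: m_def of_nat_diff)
      ultimately show ?thesis by (metis ln_less_cancel_iff less_add_one add_pos_pos zero_less_one)
    qed
    finally show False by simp
  qed
next
  fix f :: "real \<Rightarrow> real"
  assume A: "\<forall>k::nat. 0 < k \<longrightarrow> (\<exists>n\<in>A. k dvd n)"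
    and f: "continuous_on {0..1} f \<and> f ` {0..1} \<subseteq> {0..1}"
  show "topological_entropy f {0..1} = topological_entropy f (closure (periodic_points f A))"
  proof (rule antisym)
    show "topological_entropy f {0..1} \<le> topological_entropy f (closure (periodic_points f A))"
      using f A assms by (intro entropy_le_periodic_closure) auto
    show "topological_entropy f (closure (periodic_points f A)) \<le> topological_entropy f {0..1}"
      by (intro topological_entropy_mono closure_minimal periodic_points_subset) auto
  qed
qed

end
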